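(* Let $(M,g)$ be a connected homogeneous Lorentzian manifold of dimension $D\geq 3$ that admits a non-degenerate homogeneous structure of type $\mathcal{T}_{1}\oplus\mathcal{T}_{3}$. Then $(M,g)$ is a locally symmetric space, i.e. $\nabla R=0$, where $\nabla$ is the Levi-Civita connection of $g$ and $R$ its Riemann curvature tensor.
   Context: A Lorentzian manifold $(M,g)$ is homogeneous if its isometry group acts transitively on $M$. Homogeneous structure: let $\nabla$ be the Levi-Civita connection of $g$ and $R$ its Riemann curvature tensor. A homogeneous structure on $(M,g)$ is a $(1,2)$-tensor field $S$, written $(X,Y)\mapsto S_{X}Y$, such that the connection $\overline{\nabla}=\nabla-S$ satisfies $\overline{\nabla}g=0$, $\overline{\nabla}R=0$ and $\overline{\nabla}S=0$. Type $\mathcal{T}_{1}\oplus\mathcal{T}_{3}$: the homogeneous structure $S$ is of type $\mathcal{T}_{1}\oplus\mathcal{T}_{3}$ if there are a vector field $\xi$ and a $(1,2)$-tensor field $T$, for which $T(X,Y,Z):=g(T_{X}Y,Z)$ is totally antisymmetric (a 3-form), such that for all vector fields $X,Y$ $$S_{X}Y = T_{X}Y + g(X,Y)\,\xi - \alpha(Y)\,X,\qquad \alpha(X):=g(\xi,X).$$ Here $T$ is the $\mathcal{T}_{3}$ contribution (it is allowed to vanish) and $\xi$ characterizes the $\mathcal{T}_{1}$ contribution. Non-degenerate: such a structure is called non-degenerate if $\xi$ has non-vanishing norm, i.e. $g(\xi,\xi)\neq 0$ ($\xi$ is space-like or time-like). *)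

theory Defs
  imports "HOL-Analysis.Analysis" "HOL-Library.Function_Algebras"
begin

text \<open>Pointwise real vector space structure on functions. Smooth functions, tangent vectors and
  vector fields are all functions here, so this makes the library's \<open>span\<close> and \<open>independent\<close>
  available for them.\<close>

instantiation "fun" :: (type, scaleR) scaleR
begin
definition scaleR_fun_def: "c *\<^sub>R f = (\<lambda>x. c *\<^sub>R f x)"
instance ..
end

instance "fun" :: (type, real_vector) real_vector
  by standard (simp_all add: scaleR_fun_def plus_fun_def fun_eq_iff scaleR_add_right scaleR_add_left)


section \<open>Smooth manifolds\<close>

text \<open>On an open set, a map is of class \<open>C\<^sup>k\<^sup>+\<^sup>1\<close> iff it is differentiable and all its directional
  derivatives are of class \<open>C\<^sup>k\<close>; the definition is meant for open \<open>S\<close> only.\<close>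

fun Ck_on :: "nat \<Rightarrow> 'a::euclidean_space set \<Rightarrow> ('a \<Rightarrow> 'b::real_normed_vector) \<Rightarrow> bool" where
  "Ck_on 0 S f \<longleftrightarrow> continuous_on S f"
| "Ck_on (Suc k) S f \<longleftrightarrow>
     (\<forall>x\<in>S. f differentiable (at x)) \<and> (\<forall>v. Ck_on k S (\<lambda>x. frechet_derivative f (at x) v))"

definition smooth_on :: "'a::euclidean_space set \<Rightarrow> ('a \<Rightarrow> 'b::real_normed_vector) \<Rightarrow> bool" where
  "smooth_on S f \<longleftrightarrow> (\<forall>k. Ck_on k S f)"

text \<open>The manifold is the whole type \<open>'m\<close>; its dimension is \<open>CARD('n)\<close>. In a chart \<open>(U, \<phi>)\<close> only
  the values of \<open>\<phi>\<close> on \<open>U\<close> matter.\<close>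

type_synonym ('m, 'n) chart = "'m set \<times> ('m \<Rightarrow> real ^ 'n)"

definition is_chart :: "('m::topological_space, 'n::finite) chart \<Rightarrow> bool" where
  "is_chart c \<longleftrightarrow> (case c of (U, \<phi>) \<Rightarrow>
     open U \<and> open (\<phi> ` U) \<and> inj_on \<phi> U \<and> homeomorphism U (\<phi> ` U) \<phi> (inv_into U \<phi>))"

definition smooth_manifold ::
    "('m::{t2_space, second_countable_topology}, 'n::finite) chart set \<Rightarrow> bool" where
  "smooth_manifold A \<longleftrightarrow>
     (\<forall>c\<in>A. is_chart c) \<and> (\<Union>(U, \<phi>)\<in>A. U) = UNIV \<and>
     (\<forall>(U, \<phi>)\<in>A. \<forall>(V, \<psi>)\<in>A. smooth_on (\<phi> ` (U \<inter> V)) (\<psi> \<circ> inv_into U \<phi>))"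

definition smooth_fun :: "('m, 'n::finite) chart set \<Rightarrow> ('m \<Rightarrow> real) \<Rightarrow> bool" where
  "smooth_fun A f \<longleftrightarrow> (\<forall>(U, \<phi>)\<in>A. smooth_on (\<phi> ` U) (f \<circ> inv_into U \<phi>))"

definition diffeomorphism ::
    "('m::topological_space, 'n::finite) chart set \<Rightarrow> ('m \<Rightarrow> 'm) \<Rightarrow> bool" where
  "diffeomorphism A F \<longleftrightarrow> bij F \<and>
     (\<forall>G\<in>{F, inv F}. continuous_on UNIV G \<and>
        (\<forall>(U, \<phi>)\<in>A. \<forall>(V, \<psi>)\<in>A. smooth_on (\<phi> ` (U \<inter> G -` V)) (\<psi> \<circ> G \<circ> inv_into U \<phi>)))"


section \<open>Tangent vectors and vector fields\<close>

text \<open>A tangent vector at \<open>p\<close> is a derivation at \<open>p\<close> of the algebra of smooth functions. It is set to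
  0 on non-smooth functions so that equality of derivations is equality of functions.\<close>

type_synonym 'm tvec = "('m \<Rightarrow> real) \<Rightarrow> real"
type_synonym 'm vfield = "'m \<Rightarrow> 'm tvec"

definition tangent_space :: "('m, 'n::finite) chart set \<Rightarrow> 'm \<Rightarrow> 'm tvec set" where
  "tangent_space A p = {v.
     (\<forall>f g. smooth_fun A f \<longrightarrow> smooth_fun A g \<longrightarrow>
        v (f + g) = v f + v g \<and> v (f * g) = f p * v g + g p * v f) \<and>
     (\<forall>c f. smooth_fun A f \<longrightarrow> v (c *\<^sub>R f) = c * v f) \<and>
     (\<forall>f. \<not> smooth_fun A f \<longrightarrow> v f = 0)}"

definition vector_fields :: "('m, 'n::finite) chart set \<Rightarrow> 'm vfield set" where
  "vector_fields A = {X. (\<forall>p. X p \<in> tangent_space A p) \<and>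
     (\<forall>f. smooth_fun A f \<longrightarrow> smooth_fun A (\<lambda>p. X p f))}"

definition fscale :: "('m \<Rightarrow> real) \<Rightarrow> 'm vfield \<Rightarrow> 'm vfield" where
  "fscale f X = (\<lambda>p. f p *\<^sub>R X p)"

definition lie_bracket :: "'m vfield \<Rightarrow> 'm vfield \<Rightarrow> 'm vfield" where
  "lie_bracket X Y = (\<lambda>p f. X p (\<lambda>q. Y q f) - Y p (\<lambda>q. X q f))"

text \<open>The differential of \<open>F\<close>, used for diffeomorphisms only: then non-smooth functions are still
  sent to 0.\<close>

definition differential :: "('m \<Rightarrow> 'm) \<Rightarrow> 'm tvec \<Rightarrow> 'm tvec" where
  "differential F v = (\<lambda>f. v (f \<circ> F))"


section \<open>Tensor fields\<close>

text \<open>Tensor fields are given pointwise; only their values on tangent vectors are relevant.\<close>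

type_synonym 'm tensor02 = "'m \<Rightarrow> 'm tvec \<Rightarrow> 'm tvec \<Rightarrow> real"
type_synonym 'm tensor12 = "'m \<Rightarrow> 'm tvec \<Rightarrow> 'm tvec \<Rightarrow> 'm tvec"

definition bilinear_over :: "'a::real_vector set \<Rightarrow> ('a \<Rightarrow> 'a \<Rightarrow> 'b::real_vector) \<Rightarrow> bool" where
  "bilinear_over V b \<longleftrightarrow> (\<forall>u\<in>V. \<forall>v\<in>V. \<forall>w\<in>V. \<forall>c.
     b (u + v) w = b u w + b v w \<and> b w (u + v) = b w u + b w v \<and>
     b (c *\<^sub>R u) w = c *\<^sub>R b u w \<and> b w (c *\<^sub>R u) = c *\<^sub>R b w u)"

definition on_fields ::
    "('m \<Rightarrow> 'm tvec \<Rightarrow> 'm tvec \<Rightarrow> 'b) \<Rightarrow> 'm vfield \<Rightarrow> 'm vfield \<Rightarrow> 'm \<Rightarrow> 'b" where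
  "on_fields t X Y = (\<lambda>p. t p (X p) (Y p))"

definition tensor12_field :: "('m, 'n::finite) chart set \<Rightarrow> 'm tensor12 \<Rightarrow> bool" where
  "tensor12_field A S \<longleftrightarrow>
     (\<forall>p. bilinear_over (tangent_space A p) (S p)) \<and>
     (\<forall>X\<in>vector_fields A. \<forall>Y\<in>vector_fields A. on_fields S X Y \<in> vector_fields A) \<and>
     (\<forall>p. \<forall>u\<in>tangent_space A p. \<forall>v\<in>tangent_space A p. S p u v \<in> tangent_space A p)"

text \<open>Signature \<open>(-,+,\<dots>,+)\<close> is expressed by a pseudo-orthonormal basis of every tangent space, with
  \<open>e k\<close> the time-like basis vector.\<close>

definition lorentzian_metric :: "('m, 'n::finite) chart set \<Rightarrow> 'm tensor02 \<Rightarrow> bool" where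
  "lorentzian_metric A g \<longleftrightarrow>
     (\<forall>p. bilinear_over (tangent_space A p) (g p)) \<and>
     (\<forall>p. \<forall>u\<in>tangent_space A p. \<forall>v\<in>tangent_space A p. g p u v = g p v u) \<and>
     (\<forall>p. \<exists>(e :: 'n \<Rightarrow> 'm tvec) k.
        inj e \<and> independent (range e) \<and> span (range e) = tangent_space A p \<and>
        (\<forall>i j. g p (e i) (e j) = (if i \<noteq> j then 0 else if i = k then -1 else 1))) \<and>
     (\<forall>X\<in>vector_fields A. \<forall>Y\<in>vector_fields A. smooth_fun A (on_fields g X Y))"

definition isometry ::
    "('m::topological_space, 'n::finite) chart set \<Rightarrow> 'm tensor02 \<Rightarrow> ('m \<Rightarrow> 'm) \<Rightarrow> bool" where
  "isometry A g F \<longleftrightarrow> diffeomorphism A F \<and>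
     (\<forall>p. \<forall>u\<in>tangent_space A p. \<forall>v\<in>tangent_space A p.
        g (F p) (differential F u) (differential F v) = g p u v)"

definition homogeneous ::
    "('m::topological_space, 'n::finite) chart set \<Rightarrow> 'm tensor02 \<Rightarrow> bool" where
  "homogeneous A g \<longleftrightarrow> (\<forall>p q. \<exists>F. isometry A g F \<and> F p = q)"


section \<open>Connections and curvature\<close>

type_synonym 'm conn = "'m vfield \<Rightarrow> 'm vfield \<Rightarrow> 'm vfield"

definition linear_connection :: "('m, 'n::finite) chart set \<Rightarrow> 'm conn \<Rightarrow> bool" where
  "linear_connection A D \<longleftrightarrow>
     (\<forall>X\<in>vector_fields A. \<forall>Y\<in>vector_fields A. D X Y \<in> vector_fields A) \<and>
     (\<forall>X\<in>vector_fields A. \<forall>Y\<in>vector_fields A. \<forall>Z\<in>vector_fields A.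
        D (X + Y) Z = D X Z + D Y Z \<and> D X (Y + Z) = D X Y + D X Z) \<and>
     (\<forall>X\<in>vector_fields A. \<forall>Y\<in>vector_fields A. \<forall>f. smooth_fun A f \<longrightarrow>
        D (fscale f X) Y = fscale f (D X Y) \<and>
        D X (fscale f Y) = fscale (\<lambda>p. X p f) Y + fscale f (D X Y))"

text \<open>Covariant derivatives in direction \<open>X\<close> of a tensor field of type (0,2), (1,2) and (1,3).\<close>

definition cov_deriv02 ::
    "'m conn \<Rightarrow> 'm tensor02 \<Rightarrow> 'm vfield \<Rightarrow> 'm vfield \<Rightarrow> 'm vfield \<Rightarrow> 'm \<Rightarrow> real" where
  "cov_deriv02 D h X Y Z = (\<lambda>p. X p (on_fields h Y Z)) - on_fields h (D X Y) Z - on_fields h Y (D X Z)"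

definition cov_deriv12 ::
    "'m conn \<Rightarrow> 'm tensor12 \<Rightarrow> 'm vfield \<Rightarrow> 'm vfield \<Rightarrow> 'm vfield \<Rightarrow> 'm vfield" where
  "cov_deriv12 D S X Y Z = D X (on_fields S Y Z) - on_fields S (D X Y) Z - on_fields S Y (D X Z)"

definition cov_deriv13 ::
    "'m conn \<Rightarrow> ('m vfield \<Rightarrow> 'm vfield \<Rightarrow> 'm vfield \<Rightarrow> 'm vfield) \<Rightarrow>
      'm vfield \<Rightarrow> 'm vfield \<Rightarrow> 'm vfield \<Rightarrow> 'm vfield \<Rightarrow> 'm vfield" where
  "cov_deriv13 D R X Y Z W = D X (R Y Z W) - R (D X Y) Z W - R Y (D X Z) W - R Y Z (D X W)"

definition levi_civita :: "('m, 'n::finite) chart set \<Rightarrow> 'm tensor02 \<Rightarrow> 'm conn \<Rightarrow> bool" where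
  "levi_civita A g D \<longleftrightarrow> linear_connection A D \<and>
     (\<forall>X\<in>vector_fields A. \<forall>Y\<in>vector_fields A. D X Y - D Y X = lie_bracket X Y) \<and>
     (\<forall>X\<in>vector_fields A. \<forall>Y\<in>vector_fields A. \<forall>Z\<in>vector_fields A. cov_deriv02 D g X Y Z = 0)"

definition curvature :: "'m conn \<Rightarrow> 'm vfield \<Rightarrow> 'm vfield \<Rightarrow> 'm vfield \<Rightarrow> 'm vfield" where
  "curvature D X Y Z = D X (D Y Z) - D Y (D X Z) - D (lie_bracket X Y) Z"

definition locally_symmetric :: "('m, 'n::finite) chart set \<Rightarrow> 'm conn \<Rightarrow> bool" where
  "locally_symmetric A D \<longleftrightarrow>
     (\<forall>X\<in>vector_fields A. \<forall>Y\<in>vector_fields A. \<forall>Z\<in>vector_fields A. \<forall>W\<in>vector_fields A.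
        cov_deriv13 D (curvature D) X Y Z W = 0)"


section \<open>Homogeneous structures\<close>

text \<open>Here \<open>D\<close> is the Levi-Civita connection of \<open>g\<close>. The curvature that has to be parallel is that of
  \<open>D\<close>, not that of \<open>D - S\<close>.\<close>

definition homogeneous_structure ::
    "('m, 'n::finite) chart set \<Rightarrow> 'm tensor02 \<Rightarrow> 'm conn \<Rightarrow> 'm tensor12 \<Rightarrow> bool" where
  "homogeneous_structure A g D S \<longleftrightarrow> tensor12_field A S \<and>
     (let D' = (\<lambda>X Y. D X Y - on_fields S X Y) in
      \<forall>X\<in>vector_fields A. \<forall>Y\<in>vector_fields A. \<forall>Z\<in>vector_fields A.
        cov_deriv02 D' g X Y Z = 0 \<and>
        (\<forall>W\<in>vector_fields A. cov_deriv13 D' (curvature D) X Y Z W = 0) \<and>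
        cov_deriv12 D' S X Y Z = 0)"

definition T1_T3_decomposition ::
    "('m, 'n::finite) chart set \<Rightarrow> 'm tensor02 \<Rightarrow> 'm tensor12 \<Rightarrow> 'm vfield \<Rightarrow> 'm tensor12 \<Rightarrow> bool" where
  "T1_T3_decomposition A g S \<xi> T \<longleftrightarrow>
     \<xi> \<in> vector_fields A \<and> tensor12_field A T \<and>
     (\<forall>p. \<forall>u\<in>tangent_space A p. \<forall>v\<in>tangent_space A p. \<forall>w\<in>tangent_space A p.
        g p (T p u v) w = - g p (T p v u) w \<and> g p (T p u v) w = - g p (T p u w) v) \<and>
     (\<forall>p. \<forall>u\<in>tangent_space A p. \<forall>v\<in>tangent_space A p.
        S p u v = T p u v + g p u v *\<^sub>R \<xi> p - g p (\<xi> p) v *\<^sub>R u)"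

definition nondegenerate_type_T1_T3 ::
    "('m, 'n::finite) chart set \<Rightarrow> 'm tensor02 \<Rightarrow> 'm tensor12 \<Rightarrow> bool" where
  "nondegenerate_type_T1_T3 A g S \<longleftrightarrow>
     (\<exists>\<xi> T. T1_T3_decomposition A g S \<xi> T \<and> (\<forall>p. g p (\<xi> p) (\<xi> p) \<noteq> 0))"

end

theory Submission
  imports Defs
begin

text \<open>The space turns out to have constant curvature. Put \<open>\<kappa> = g(\<xi>,\<xi>)\<close>. Evaluating
  \<open>\<nabla>' S = 0\<close>, where \<open>\<nabla>' = \<nabla> - S\<close>, on pairs \<open>(X, X)\<close> eliminates \<open>T\<close> and gives \<open>\<nabla>' \<xi> = 0\<close>; hence
  \<open>\<kappa>\<close> is annihilated by all fields, \<open>\<nabla>\<^sub>X \<xi> = S\<^sub>X \<xi>\<close> and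
  \<open>R(X,Y)\<xi> = [S\<^sub>X, S\<^sub>Y]\<xi> - S\<^bsub>S\<^sub>X Y - S\<^sub>Y X\<^esub> \<xi>\<close>. In \<open>R(X,\<xi>)\<xi>\<close> the only part that is skew in \<open>X\<close> is
  \<open>-2 \<kappa> T\<^sub>\<xi> X\<close>, so the pair symmetry of \<open>R\<close> forces \<open>T\<^sub>\<xi> = 0\<close>. Then \<open>S\<^sub>\<xi> = 0\<close>, so \<open>\<nabla>\<^sub>\<xi> R = \<nabla>'\<^sub>\<xi> R = 0\<close>,
  and \<open>R(X,Y)\<xi> = \<kappa> (g(X,\<xi>) Y - g(Y,\<xi>) X)\<close>. The second Bianchi identity for \<open>X, Y, \<xi>\<close> now yields
  \<open>R(X,Y)Z = \<kappa> (g(X,Z) Y - g(Y,Z) X)\<close>, which is parallel.\<close>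

section \<open>Smooth functions and bump functions\<close>

lemma Ck_on_Suc_imp: "Ck_on (Suc k) S f \<Longrightarrow> Ck_on k S f"
proof (induction k arbitrary: f)
  case 0
  then show ?case
    by (simp add: continuous_on_eq_continuous_within)
      (meson continuous_at_imp_continuous_within differentiable_imp_continuous_within)
next
  case (Suc k)
  then show ?case by (metis Ck_on.simps(2))
qed

lemma frechet_derivative_cong_open:
  assumes "open S" "x \<in> S" "\<And>x. x \<in> S \<Longrightarrow> f x = h x"
  shows "frechet_derivative f (at x) = frechet_derivative h (at x)"
proof -
  have "(f has_derivative d) (at x) \<longleftrightarrow> (h has_derivative d) (at x)" for d
    using assms has_derivative_transform_within_open[of f d x UNIV S h]
      has_derivative_transform_within_open[of h d x UNIV S f] by auto
  then show ?thesis by (simp add: frechet_derivative_def)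
qed

lemma differentiable_cong_open:
  assumes "open S" "x \<in> S" "\<And>x. x \<in> S \<Longrightarrow> f x = h x" "f differentiable at x"
  shows "h differentiable at x"
  using assms has_derivative_transform_within_open[of f _ x UNIV S h]
  unfolding differentiable_def by blast

lemma Ck_on_cong:
  assumes "open S" "\<And>x. x \<in> S \<Longrightarrow> f x = h x" "Ck_on k S f"
  shows "Ck_on k S h"
  using assms(2,3)
proof (induction k arbitrary: f h)
  case 0
  then show ?case by (simp cong: continuous_on_cong)
next
  case (Suc k)
  have "frechet_derivative f (at x) v = frechet_derivative h (at x) v" if "x \<in> S" for x v
    using frechet_derivative_cong_open[OF assms(1) that Suc.prems(1)] by simp
  then have "Ck_on k S (\<lambda>x. frechet_derivative h (at x) v)" for v
    using Suc.IH[of "\<lambda>x. frechet_derivative f (at x) v"] Suc.prems(2) by simp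
  moreover have "h differentiable at x" if "x \<in> S" for x
    using differentiable_cong_open[OF assms(1) that Suc.prems(1)] Suc.prems(2) that by simp
  ultimately show ?case by simp
qed

text \<open>Allows an explicitly known derivative to replace the chosen
  \<open>frechet_derivative\<close>; openness of \<open>S\<close> makes the two interchangeable at
  every order.\<close>

lemma Ck_on_SucI:
  assumes "open S" "\<And>x. x \<in> S \<Longrightarrow> (f has_derivative f' x) (at x)" "\<And>v. Ck_on k S (\<lambda>x. f' x v)"
  shows "Ck_on (Suc k) S f"
proof -
  have "Ck_on k S (\<lambda>x. frechet_derivative f (at x) v)" for v
    by (rule Ck_on_cong[OF assms(1) _ assms(3)[of v]]) (simp add: frechet_derivative_at[OF assms(2), symmetric])
  then show ?thesis using differentiableI[OF assms(2)] by simp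
qed

lemma Ck_on_Un:
  assumes "open S" "open T" "Ck_on k S f" "Ck_on k T f"
  shows "Ck_on k (S \<union> T) f"
  using assms(3,4)
  by (induction k arbitrary: f) (auto intro: continuous_on_open_Un assms(1,2))

lemma Ck_on_const: "Ck_on k S (\<lambda>x. c)"
  by (induction k arbitrary: c) auto

lemma Ck_on_linear:
  assumes "open S" "bounded_linear L" "Ck_on k S f"
  shows "Ck_on k S (\<lambda>x. L (f x))"
  using assms(3)
proof (induction k arbitrary: f)
  case 0
  then show ?case using bounded_linear.continuous_on[OF assms(2)] by simp
next
  case (Suc k)
  have d: "((\<lambda>x. L (f x)) has_derivative (\<lambda>v. L (frechet_derivative f (at x) v))) (at x)" if "x \<in> S" for x
    using Suc.prems that
    by (intro bounded_linear.has_derivative[OF assms(2)]) (simp add: frechet_derivative_works)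
  show ?case
    using Suc.prems by (intro Ck_on_SucI[OF assms(1) d] Suc.IH) auto
qed

lemma Ck_on_id: "Ck_on k S (\<lambda>x. x)"
  by (cases k) (auto simp: Ck_on_const)

lemma Ck_on_add:
  assumes "open S" "Ck_on k S f" "Ck_on k S h"
  shows "Ck_on k S (\<lambda>x. f x + h x)"
  using assms(2,3)
proof (induction k arbitrary: f h)
  case 0
  then show ?case by (auto intro: continuous_intros)
next
  case (Suc k)
  have d: "((\<lambda>x. f x + h x) has_derivative
      (\<lambda>v. frechet_derivative f (at x) v + frechet_derivative h (at x) v)) (at x)" if "x \<in> S" for x
    using Suc.prems that by (auto intro!: derivative_eq_intros simp: frechet_derivative_works)
  show ?case
    using Suc.prems by (intro Ck_on_SucI[OF assms(1) d] Suc.IH) auto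
qed

lemma Ck_on_mult:
  fixes f h :: "'a::euclidean_space \<Rightarrow> real"
  assumes "open S" "Ck_on k S f" "Ck_on k S h"
  shows "Ck_on k S (\<lambda>x. f x * h x)"
  using assms(2,3)
proof (induction k arbitrary: f h)
  case 0
  then show ?case by (auto intro: continuous_intros)
next
  case (Suc k)
  have d: "((\<lambda>x. f x * h x) has_derivative
      (\<lambda>v. f x * frechet_derivative h (at x) v + frechet_derivative f (at x) v * h x)) (at x)" if "x \<in> S" for x
    using Suc.prems that by (auto intro!: derivative_eq_intros simp: frechet_derivative_works)
  \<comment> \<open>The undifferentiated factors must be of class C^k as well, hence
    \<open>Ck_on_Suc_imp\<close>.\<close>
  have "Ck_on k S (\<lambda>x. f x * frechet_derivative h (at x) v + frechet_derivative f (at x) v * h x)" for v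
    using Suc.prems Suc.prems[THEN Ck_on_Suc_imp] by (intro Ck_on_add assms(1) Suc.IH) auto
  then show ?case
    by (intro Ck_on_SucI[OF assms(1) d]) auto
qed

lemma Ck_on_sum:
  assumes "open S" "finite I" "\<And>i. i \<in> I \<Longrightarrow> Ck_on k S (f i)"
  shows "Ck_on k S (\<lambda>x. \<Sum>i\<in>I. f i x)"
  using assms(2,3) by (induction I) (auto intro: Ck_on_const Ck_on_add[OF assms(1)])

text \<open>\<open>Ck_on\<close> controls derivatives only in fixed directions, whereas the chain
  rule differentiates \<open>f\<close> in the direction Dh(x)v, which moves with x. Expanding that
  direction in \<open>Basis\<close> gives a finite sum of products of C^k functions.\<close>

lemma Ck_on_compose:
  fixes f :: "'b::euclidean_space \<Rightarrow> real" and h :: "'a::euclidean_space \<Rightarrow> 'b"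
  assumes "open S" "Ck_on k T f" "Ck_on k S h" "h ` S \<subseteq> T"
  shows "Ck_on k S (\<lambda>x. f (h x))"
  using assms(2,3)
proof (induction k arbitrary: f)
  case 0
  then show ?case using assms(4) by (auto intro: continuous_on_compose2)
next
  case (Suc k)
  have d: "((\<lambda>x. f (h x)) has_derivative
      (\<lambda>v. \<Sum>b\<in>Basis. (frechet_derivative h (at x) v \<bullet> b) * frechet_derivative f (at (h x)) b)) (at x)"
    if "x \<in> S" for x
  proof -
    have df: "(f has_derivative frechet_derivative f (at (h x))) (at (h x))"
      using Suc.prems that assms(4) by (auto simp: frechet_derivative_works)
    have dh: "(h has_derivative frechet_derivative h (at x)) (at x)"
      using Suc.prems that by (auto simp: frechet_derivative_works)
    have lin: "linear (frechet_derivative f (at (h x)))"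
      using df has_derivative_linear by blast
    have "(\<lambda>v. \<Sum>b\<in>Basis. (frechet_derivative h (at x) v \<bullet> b) * frechet_derivative f (at (h x)) b)
        = (\<lambda>v. frechet_derivative f (at (h x)) (frechet_derivative h (at x) v))"
    proof
      fix v
      have "frechet_derivative f (at (h x)) (frechet_derivative h (at x) v)
          = frechet_derivative f (at (h x)) (\<Sum>b\<in>Basis. (frechet_derivative h (at x) v \<bullet> b) *\<^sub>R b)"
        by (simp add: euclidean_representation)
      then show "(\<Sum>b\<in>Basis. (frechet_derivative h (at x) v \<bullet> b) * frechet_derivative f (at (h x)) b)
          = frechet_derivative f (at (h x)) (frechet_derivative h (at x) v)"
        by (simp add: linear_sum[OF lin] linear_scale[OF lin])
    qed
    then show ?thesis
      using has_derivative_compose[OF dh df] by simp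
  qed
  have "Ck_on k S (\<lambda>x. \<Sum>b\<in>Basis. (frechet_derivative h (at x) v \<bullet> b) * frechet_derivative f (at (h x)) b)" for v
    using Suc.prems
    by (intro Ck_on_sum assms(1) Ck_on_mult)
      (auto intro!: Suc.IH[of "\<lambda>y. frechet_derivative f (at y) _"]  Ck_on_Suc_imp[of k S h]
        Ck_on_linear[OF assms(1) bounded_linear_inner_left, of k "\<lambda>x. frechet_derivative h (at x) v"])
  then show ?case
    by (intro Ck_on_SucI[OF assms(1) d]) auto
qed

section \<open>A flat function and compactly supported bumps\<close>

text \<open>The exponent \<open>j\<close> makes the family closed under differentiation, up to linear combinations.\<close>

definition flat_exp :: "nat \<Rightarrow> real \<Rightarrow> real" where
  "flat_exp j t = (if t > 0 then (1 / t) ^ j * exp (- 1 / t) else 0)"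

text \<open>The substitution x = 1/t turns this into the decay of x^j / exp x at infinity.\<close>

lemma flat_exp_at_right: "((\<lambda>t. flat_exp j t) \<longlongrightarrow> 0) (at_right 0)"
proof -
  have "((\<lambda>t::real. (1 / t) ^ j * exp (- 1 / t)) \<longlongrightarrow> 0) (at_right 0)"
  proof -
    have "((\<lambda>x::real. x ^ j / exp x) \<longlongrightarrow> 0) at_top"
      by (rule tendsto_power_div_exp_0)
    then have "((\<lambda>t::real. inverse t ^ j / exp (inverse t)) \<longlongrightarrow> 0) (at_right 0)"
      by (rule filterlim_compose[OF _ filterlim_inverse_at_top_right])
    then show ?thesis
      by (simp add: exp_minus field_simps)
  qed
  moreover have "\<forall>\<^sub>F t in at_right 0. (1 / t) ^ j * exp (- 1 / t) = flat_exp j t"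
    by (auto simp: eventually_at_filter flat_exp_def)
  ultimately show ?thesis by (rule Lim_transform_eventually)
qed

lemma flat_exp_at_0: "(flat_exp j \<longlongrightarrow> 0) (at 0)"
proof -
  have "(flat_exp j \<longlongrightarrow> 0) (at_left 0)"
    by (rule Lim_transform_eventually[of "\<lambda>_. 0"]) (auto simp: eventually_at_filter flat_exp_def)
  then show ?thesis using flat_exp_at_right[of j] by (simp add: filterlim_split_at)
qed

lemma flat_exp_deriv:
  "(flat_exp j has_real_derivative flat_exp (j + 2) t - j * flat_exp (j + 1) t) (at t)"
proof -
  consider "t > 0" | "t < 0" | "t = 0" by linarith
  then show ?thesis
  proof cases
    case 1
    have "((\<lambda>t. (1 / t) ^ j * exp (- 1 / t)) has_real_derivative
        flat_exp (j + 2) t - j * flat_exp (j + 1) t) (at t)"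
    proof -
      have "((\<lambda>t. (1 / t) ^ j * exp (- 1 / t)) has_real_derivative
          j * (1 / t) ^ (j - 1) * (- 1 / t\<^sup>2) * exp (- 1 / t) + (1 / t) ^ j * (exp (- 1 / t) * (1 / t\<^sup>2))) (at t)"
        using 1 by (auto intro!: derivative_eq_intros simp: power2_eq_square)
      \<comment> \<open>For j = 0 the truncated exponent \<open>j - 1\<close> is harmless, since the
        factor j vanishes.\<close>
      moreover have "j * (1 / t) ^ (j - 1) * (- 1 / t\<^sup>2) = - (j * (1 / t) ^ (j + 1))"
        using 1 by (cases j) (auto simp: power2_eq_square field_simps)
      moreover have "- (j * (1 / t) ^ (j + 1)) * exp (- 1 / t) + (1 / t) ^ j * (exp (- 1 / t) * (1 / t\<^sup>2))
          = flat_exp (j + 2) t - j * flat_exp (j + 1) t"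
        using 1 by (simp add: flat_exp_def power_add power2_eq_square field_simps)
      ultimately show ?thesis by metis
    qed
    then show ?thesis
      by (rule has_field_derivative_transform_within_open[of _ _ _ "{0<..}"]) (use 1 in \<open>auto simp: flat_exp_def\<close>)
  next
    case 2
    have "((\<lambda>t::real. 0) has_real_derivative flat_exp (j + 2) t - j * flat_exp (j + 1) t) (at t)"
      using 2 by (simp add: flat_exp_def)
    then show ?thesis
      by (rule has_field_derivative_transform_within_open[of _ _ _ "{..<0}"]) (use 2 in \<open>auto simp: flat_exp_def\<close>)
  next
    case 3
    \<comment> \<open>The difference quotient at 0 is itself a member of the family, so the limit is
      already known; at h = 0 both sides are 0.\<close>
    have "(\<lambda>h. (flat_exp j (0 + h) - flat_exp j 0) / h) = flat_exp (j + 1)"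
      by (auto simp: flat_exp_def fun_eq_iff)
    then show ?thesis
      using flat_exp_at_0[of "j + 1"] unfolding 3 DERIV_def by (simp add: flat_exp_def)
  qed
qed

lemma Ck_on_flat_exp: "Ck_on k UNIV (flat_exp j)"
proof (induction k arbitrary: j)
  case 0
  then show ?case
    by (auto intro!: continuous_at_imp_continuous_on DERIV_isCont[OF flat_exp_deriv])
next
  case (Suc k)
  have d: "(flat_exp j has_derivative (\<lambda>v. (flat_exp (j + 2) t + - real j * flat_exp (j + 1) t) * v)) (at t)" for t
    using flat_exp_deriv[of j t] by (simp add: has_field_derivative_def)
  have "Ck_on k UNIV (\<lambda>t. (flat_exp (j + 2) t + - real j * flat_exp (j + 1) t) * v)" for v
    by (intro Ck_on_mult Ck_on_add Ck_on_const Suc.IH open_UNIV)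
  then show ?case by (intro Ck_on_SucI[OF open_UNIV d])
qed

text \<open>The bump is exp(-1/(r^2 - |x - a|^2)) inside a ball and 0 outside. The compact set
  \<open>K\<close> is what later permits extension by zero from a chart to the whole
  manifold.\<close>

lemma smooth_bump_exists:
  fixes a :: "'a::euclidean_space"
  assumes "open S" "a \<in> S"
  shows "\<exists>(\<beta> :: 'a \<Rightarrow> real) K. (\<forall>k T. open T \<longrightarrow> Ck_on k T \<beta>) \<and> \<beta> a \<noteq> 0 \<and>
    compact K \<and> K \<subseteq> S \<and> (\<forall>x. x \<notin> K \<longrightarrow> \<beta> x = 0)"
proof -
  obtain r where r: "r > 0" "cball a r \<subseteq> S"
    using assms open_contains_cball by blast
  \<comment> \<open>The squared distance is spelled out with sums, products and negated summands so
    that the closure rules for \<open>Ck_on\<close> apply literally.\<close>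
  define \<beta> where "\<beta> x = flat_exp 0 (r\<^sup>2 + - (\<Sum>b\<in>Basis. ((x + - a) \<bullet> b) * ((x + - a) \<bullet> b)))" for x
  have dist: "(\<Sum>b\<in>Basis. ((x + - a) \<bullet> b) * ((x + - a) \<bullet> b)) = (dist a x)\<^sup>2" for x
    using euclidean_inner[of "x - a" "x - a"] power2_norm_eq_inner[of "x - a"]
    by (simp add: dist_norm norm_minus_commute)
  show ?thesis
  proof (intro exI conjI allI impI)
    show "Ck_on k T \<beta>" if "open T" for k T
      unfolding \<beta>_def
      by (intro Ck_on_compose[OF that Ck_on_flat_exp] Ck_on_add that Ck_on_const
          Ck_on_linear[OF that bounded_linear_minus[OF bounded_linear_ident]] Ck_on_sum Ck_on_mult
          Ck_on_linear[OF that bounded_linear_inner_left] Ck_on_id) auto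
    show "\<beta> a \<noteq> 0" using r by (simp add: \<beta>_def flat_exp_def)
    show "\<beta> x = 0" if "x \<notin> cball a r" for x
    proof -
      have "r\<^sup>2 \<le> (dist a x)\<^sup>2"
        using that r by (intro power_mono) auto
      then show ?thesis unfolding \<beta>_def dist by (simp add: flat_exp_def)
    qed
  qed (use r in auto)
qed

section \<open>Vector fields\<close>

locale smooth_mfd =
  fixes A :: "('m::{t2_space, second_countable_topology}, 'n::finite) chart set"
  assumes smooth_manifold: "smooth_manifold A"
begin

section \<open>Smooth functions in charts\<close>

lemma chartD:
  assumes "(U, \<phi>) \<in> A"
  shows "open U" "open (\<phi> ` U)" "inj_on \<phi> U" "homeomorphism U (\<phi> ` U) \<phi> (inv_into U \<phi>)"
  using assms smooth_manifold unfolding smooth_manifold_def is_chart_def by auto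

lemma chart_transition:
  assumes "(U, \<phi>) \<in> A" "(V, \<psi>) \<in> A"
  shows "Ck_on k (\<phi> ` (U \<inter> V)) (\<lambda>x. \<psi> (inv_into U \<phi> x))"
  using assms smooth_manifold unfolding smooth_manifold_def smooth_on_def by (fastforce simp: o_def)

lemma chart_image_open:
  assumes "(U, \<phi>) \<in> A" "open W" "W \<subseteq> U"
  shows "open (\<phi> ` W)"
  using homeomorphism_imp_open_map[OF chartD(4)[OF assms(1)], of W] assms chartD[OF assms(1)]
  by (metis inf.absorb_iff2 open_openin_trans openin_open_eq openin_open_trans openin_open_Int)

lemma smooth_fun_iff:
  "smooth_fun A f \<longleftrightarrow> (\<forall>(U, \<phi>)\<in>A. \<forall>k. Ck_on k (\<phi> ` U) (\<lambda>x. f (inv_into U \<phi> x)))"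
  by (simp add: smooth_fun_def smooth_on_def o_def)

lemma smooth_fun_const: "smooth_fun A (\<lambda>_. c)"
  by (auto simp: smooth_fun_iff Ck_on_const)

lemma smooth_fun_add: "smooth_fun A f \<Longrightarrow> smooth_fun A h \<Longrightarrow> smooth_fun A (\<lambda>p. f p + h p)"
  using chartD(2) by (fastforce simp: smooth_fun_iff intro: Ck_on_add)

lemma smooth_fun_mult: "smooth_fun A f \<Longrightarrow> smooth_fun A h \<Longrightarrow> smooth_fun A (\<lambda>p. f p * h p)"
  using chartD(2) by (fastforce simp: smooth_fun_iff intro: Ck_on_mult)

text \<open>The preimage \<open>K'\<close> of \<open>K\<close> is compact, hence closed because the
  manifold is Hausdorff. So any chart domain \<open>V\<close> is the union of the open sets
  \<open>V \<inter> U\<close>, where a transition map gives smoothness, and \<open>V - K'\<close>,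
  where the function vanishes.\<close>

lemma smooth_fun_chart_extension:
  assumes chart: "(U, \<phi>) \<in> A" and h: "\<And>k. Ck_on k (\<phi> ` U) h"
    and K: "compact K" "K \<subseteq> \<phi> ` U" "\<And>x. x \<in> \<phi> ` U - K \<Longrightarrow> h x = 0"
  shows "smooth_fun A (\<lambda>q. if q \<in> U then h (\<phi> q) else 0)"
  unfolding smooth_fun_iff
proof (intro ballI allI, safe)
  fix V \<psi> k
  assume V: "(V, \<psi>) \<in> A"
  let ?f = "\<lambda>q. if q \<in> U then h (\<phi> q) else 0"
  define K' where "K' = inv_into U \<phi> ` K"
  have "continuous_on K (inv_into U \<phi>)"
    using chartD(4)[OF chart] K(2) by (meson continuous_on_subset homeomorphism_cont2)
  then have "closed K'"
    unfolding K'_def using K(1) by (intro compact_imp_closed compact_continuous_image)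
  have "K' \<subseteq> U"
    unfolding K'_def using K(2) by (meson image_subsetI inv_into_into subsetD)
  have op1: "open (\<psi> ` (V \<inter> U))"
    using chart_image_open[OF V] chartD(1)[OF V] chartD(1)[OF chart] by blast
  have op2: "open (\<psi> ` (V - K'))"
    using chart_image_open[OF V] chartD(1)[OF V] \<open>closed K'\<close> by blast
  have "\<psi> ` V = \<psi> ` (V \<inter> U) \<union> \<psi> ` (V - K')"
    using \<open>K' \<subseteq> U\<close> by blast
  moreover have "Ck_on k (\<psi> ` (V \<inter> U)) (\<lambda>x. ?f (inv_into V \<psi> x))"
  proof (rule Ck_on_cong[OF op1])
    show "Ck_on k (\<psi> ` (V \<inter> U)) (\<lambda>x. h (\<phi> (inv_into V \<psi> x)))"
      by (rule Ck_on_compose[OF op1 h chart_transition[OF V chart]])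
        (use chartD(3)[OF V] in \<open>auto simp: inv_into_f_f\<close>)
  qed (use chartD(3)[OF V] in \<open>auto simp: inv_into_f_f\<close>)
  moreover have "Ck_on k (\<psi> ` (V - K')) (\<lambda>x. ?f (inv_into V \<psi> x))"
  proof (rule Ck_on_cong[OF op2 _ Ck_on_const[where c = 0]])
    fix x assume "x \<in> \<psi> ` (V - K')"
    then obtain q where q: "q \<in> V" "q \<notin> K'" "x = \<psi> q" by blast
    have "\<phi> q \<notin> K" if "q \<in> U"
      using q(2) that inv_into_f_f[OF chartD(3)[OF chart] that] unfolding K'_def by force
    then show "0 = ?f (inv_into V \<psi> x)"
      using q K(3) chartD(3)[OF V] by (auto simp: inv_into_f_f)
  qed
  ultimately show "Ck_on k (\<psi> ` V) (\<lambda>x. ?f (inv_into V \<psi> x))"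
    using Ck_on_Un[OF op1 op2] by simp
qed

section \<open>Global fields independent at a given point\<close>

lemma smooth_fun_has_derivative:
  assumes "(U, \<phi>) \<in> A" "smooth_fun A f" "p \<in> U"
  shows "((\<lambda>x. f (inv_into U \<phi> x)) has_derivative
    frechet_derivative (\<lambda>x. f (inv_into U \<phi> x)) (at (\<phi> p))) (at (\<phi> p))"
proof -
  have "Ck_on (Suc 0) (\<phi> ` U) (\<lambda>x. f (inv_into U \<phi> x))"
    using assms(1,2) unfolding smooth_fun_iff by blast
  then show ?thesis using assms(3) by (simp add: frechet_derivative_works)
qed

text \<open>The cutoff \<beta> makes the i-th coordinate field of a chart global. The value 0 on
  non-smooth functions follows the convention of \<open>tangent_space\<close>.\<close>

definition coord_field :: "'m set \<Rightarrow> ('m \<Rightarrow> real ^ 'n) \<Rightarrow> (real ^ 'n \<Rightarrow> real) \<Rightarrow> 'n \<Rightarrow> 'm vfield" where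
  "coord_field U \<phi> \<beta> i = (\<lambda>p f. if smooth_fun A f \<and> p \<in> U
     then \<beta> (\<phi> p) * frechet_derivative (\<lambda>x. f (inv_into U \<phi> x)) (at (\<phi> p)) (axis i 1) else 0)"

lemma coord_field_vector_field:
  assumes chart: "(U, \<phi>) \<in> A" and \<beta>: "\<And>k T. open T \<Longrightarrow> Ck_on k T \<beta>"
    and K: "compact K" "K \<subseteq> \<phi> ` U" "\<And>x. x \<notin> K \<Longrightarrow> \<beta> x = 0"
  shows "coord_field U \<phi> \<beta> i \<in> vector_fields A"
  unfolding vector_fields_def tangent_space_def mem_Collect_eq
proof (intro conjI allI impI)
  fix p f h c
  assume f: "smooth_fun A f" and h: "smooth_fun A h"
  note df = smooth_fun_has_derivative[OF chart f, of p]
  note dh = smooth_fun_has_derivative[OF chart h, of p]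
  have "smooth_fun A (f + h)" "smooth_fun A (f * h)"
    using smooth_fun_add[OF f h] smooth_fun_mult[OF f h] by (simp_all add: plus_fun_def times_fun_def)
  moreover have "frechet_derivative (\<lambda>x. (f + h) (inv_into U \<phi> x)) (at (\<phi> p)) (axis i 1)
      = frechet_derivative (\<lambda>x. f (inv_into U \<phi> x)) (at (\<phi> p)) (axis i 1)
      + frechet_derivative (\<lambda>x. h (inv_into U \<phi> x)) (at (\<phi> p)) (axis i 1)" if "p \<in> U"
    using frechet_derivative_at[OF has_derivative_add[OF df[OF that] dh[OF that]], symmetric] by simp
  moreover have "frechet_derivative (\<lambda>x. (f * h) (inv_into U \<phi> x)) (at (\<phi> p)) (axis i 1)
      = f p * frechet_derivative (\<lambda>x. h (inv_into U \<phi> x)) (at (\<phi> p)) (axis i 1)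
      + h p * frechet_derivative (\<lambda>x. f (inv_into U \<phi> x)) (at (\<phi> p)) (axis i 1)" if "p \<in> U"
    using frechet_derivative_at[OF has_derivative_mult[OF df[OF that] dh[OF that]], symmetric] that
    by (simp add: inv_into_f_f[OF chartD(3)[OF chart]])
  ultimately show "coord_field U \<phi> \<beta> i p (f + h) = coord_field U \<phi> \<beta> i p f + coord_field U \<phi> \<beta> i p h"
    "coord_field U \<phi> \<beta> i p (f * h) = f p * coord_field U \<phi> \<beta> i p h + h p * coord_field U \<phi> \<beta> i p f"
    by (auto simp: coord_field_def f h algebra_simps)
next
  fix p f c
  assume f: "smooth_fun A f"
  have "smooth_fun A (c *\<^sub>R f)"
    using smooth_fun_mult[OF smooth_fun_const f, of c] by (simp add: scaleR_fun_def)
  moreover have "frechet_derivative (\<lambda>x. (c *\<^sub>R f) (inv_into U \<phi> x)) (at (\<phi> p)) (axis i 1)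
      = c * frechet_derivative (\<lambda>x. f (inv_into U \<phi> x)) (at (\<phi> p)) (axis i 1)" if "p \<in> U"
    using frechet_derivative_at[OF has_derivative_mult_right[OF smooth_fun_has_derivative[OF chart f that]],
        of c, symmetric] by (simp add: scaleR_fun_def)
  ultimately show "coord_field U \<phi> \<beta> i p (c *\<^sub>R f) = c * coord_field U \<phi> \<beta> i p f"
    by (auto simp: coord_field_def f)
next
  fix f
  assume f: "smooth_fun A f"
  have "Ck_on k (\<phi> ` U) (\<lambda>x. \<beta> x * frechet_derivative (\<lambda>x. f (inv_into U \<phi> x)) (at x) (axis i 1))" for k
  proof -
    have "Ck_on (Suc k) (\<phi> ` U) (\<lambda>x. f (inv_into U \<phi> x))"
      using chart f unfolding smooth_fun_iff by blast
    then show ?thesis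
      using chartD(2)[OF chart] \<beta> by (intro Ck_on_mult) auto
  qed
  from smooth_fun_chart_extension[OF chart this K(1,2)] K(3)
  show "smooth_fun A (\<lambda>p. coord_field U \<phi> \<beta> i p f)"
    by (simp add: coord_field_def f)
qed (simp add: coord_field_def)

lemma sum_apply: "(\<Sum>i\<in>I. F i) x = (\<Sum>i\<in>I. F i x)"
  by (induction I rule: infinite_finite_induct) (simp_all add: plus_fun_def zero_fun_def)

text \<open>Cut-off coordinate fields \<open>E i\<close> are paired with cut-off coordinate
  functions \<open>y j\<close>. The matrix \<open>E i p (y j)\<close> is a nonzero multiple of the
  identity, so applying a vanishing combination to \<open>y j\<close> isolates its j-th
  coefficient.\<close>

lemma independent_vector_fields_exist:
  obtains E :: "'n \<Rightarrow> 'm vfield" where "\<And>i. E i \<in> vector_fields A"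
    "inj (\<lambda>i. E i p)" "independent (range (\<lambda>i. E i p))"
proof -
  obtain U \<phi> where chart: "(U, \<phi>) \<in> A" and p: "p \<in> U"
    using smooth_manifold unfolding smooth_manifold_def by fast
  define a where "a = \<phi> p"
  obtain \<beta> :: "real ^ 'n \<Rightarrow> real" and K where \<beta>: "\<And>k T. open T \<Longrightarrow> Ck_on k T \<beta>" "\<beta> a \<noteq> 0"
    and K: "compact K" "K \<subseteq> \<phi> ` U" "\<And>x. x \<notin> K \<Longrightarrow> \<beta> x = 0"
    using smooth_bump_exists[OF chartD(2)[OF chart], of a] p unfolding a_def by auto
  define E where "E = coord_field U \<phi> \<beta>"
  \<comment> \<open>The coordinate is shifted to vanish at \<open>a\<close>, so the derivative of
    the cutoff contributes nothing there.\<close>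
  define y where "y j q = (if q \<in> U then \<beta> (\<phi> q) * (\<phi> q \<bullet> axis j 1 + - (a \<bullet> axis j 1)) else 0)" for j q
  have E: "E i \<in> vector_fields A" for i
    unfolding E_def by (rule coord_field_vector_field[OF chart \<beta>(1) K])
  have y: "smooth_fun A (y j)" for j
    unfolding y_def using K(3) chartD(2)[OF chart]
    by (intro smooth_fun_chart_extension[OF chart _ K(1,2)] Ck_on_mult \<beta>(1) Ck_on_add
        Ck_on_linear[OF _ bounded_linear_inner_left] Ck_on_id Ck_on_const) auto
  have Ey: "E i p (y j) = (if i = j then (\<beta> a)\<^sup>2 else 0)" for i j
  proof -
    have d\<beta>: "(\<beta> has_derivative frechet_derivative \<beta> (at a)) (at a)"
      using \<beta>(1)[OF open_UNIV, of "Suc 0"] by (simp add: frechet_derivative_works)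
    have "((\<lambda>x. \<beta> x * (x \<bullet> axis j 1 + - (a \<bullet> axis j 1))) has_derivative (\<lambda>v. \<beta> a * (v \<bullet> axis j 1))) (at a)"
      by (rule derivative_eq_intros d\<beta> refl | simp)+
    then have "((\<lambda>x. y j (inv_into U \<phi> x)) has_derivative (\<lambda>v. \<beta> a * (v \<bullet> axis j 1))) (at a)"
      by (rule has_derivative_transform_within_open[OF _ chartD(2)[OF chart]])
        (use p in \<open>auto simp: a_def y_def inv_into_f_f[OF chartD(3)[OF chart]]\<close>)
    from frechet_derivative_at[OF this, symmetric] show ?thesis
      using p by (simp add: E_def coord_field_def y a_def[symmetric] inner_axis_axis power2_eq_square)
  qed
  have inj: "inj (\<lambda>i. E i p)"
    by (rule injI) (metis Ey \<beta>(2) zero_eq_power2)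
  have "independent (range (\<lambda>i. E i p))"
  proof
    assume "dependent (range (\<lambda>i. E i p))"
    then obtain u j where u: "u (E j p) \<noteq> 0" "(\<Sum>v\<in>range (\<lambda>i. E i p). u v *\<^sub>R v) = 0"
      by (auto simp: real_vector.dependent_finite)
    then have "(\<Sum>i\<in>UNIV. u (E i p) *\<^sub>R E i p) = 0"
      by (simp add: sum.reindex[OF inj])
    then have "(\<Sum>i\<in>UNIV. u (E i p) *\<^sub>R E i p) (y j) = 0" by simp
    then have "(\<Sum>i\<in>UNIV. if i = j then u (E i p) * (\<beta> a)\<^sup>2 else 0) = 0"
      by (simp add: sum_apply scaleR_fun_def Ey if_distrib cong: if_cong)
    then show False using u(1) \<beta>(2) by simp
  qed
  with E inj that show ?thesis by blast
qed

section \<open>Algebra of vector fields and the Lie bracket\<close>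

lemma tangent_add [simp]: "u \<in> tangent_space A p \<Longrightarrow> v \<in> tangent_space A p \<Longrightarrow> u + v \<in> tangent_space A p"
  by (simp add: tangent_space_def plus_fun_def algebra_simps)

lemma tangent_scale [simp]: "u \<in> tangent_space A p \<Longrightarrow> c *\<^sub>R u \<in> tangent_space A p"
  by (simp add: tangent_space_def scaleR_fun_def algebra_simps)

lemma tangent_minus [simp]: "u \<in> tangent_space A p \<Longrightarrow> - u \<in> tangent_space A p"
  using tangent_scale[of u p "-1"] by simp

lemma tangent_diff [simp]: "u \<in> tangent_space A p \<Longrightarrow> v \<in> tangent_space A p \<Longrightarrow> u - v \<in> tangent_space A p"
  using tangent_add[OF _ tangent_minus, of u p v] by simp

lemma vector_field_tangent [simp]: "X \<in> vector_fields A \<Longrightarrow> X p \<in> tangent_space A p"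
  by (simp add: vector_fields_def)

lemma vector_field_smooth: "X \<in> vector_fields A \<Longrightarrow> smooth_fun A f \<Longrightarrow> smooth_fun A (\<lambda>p. X p f)"
  unfolding vector_fields_def by blast

lemma vector_field_zero_nonsmooth: "X \<in> vector_fields A \<Longrightarrow> \<not> smooth_fun A f \<Longrightarrow> X p f = 0"
  by (simp add: vector_fields_def tangent_space_def)

lemma vector_field_derivation:
  assumes "X \<in> vector_fields A" "smooth_fun A f" "smooth_fun A h"
  shows "X p (\<lambda>q. f q + h q) = X p f + X p h" "X p (\<lambda>q. f q * h q) = f p * X p h + h p * X p f"
    "X p (\<lambda>q. f q - h q) = X p f - X p h" "X p (\<lambda>q. c * f q) = c * X p f"
proof -
  have lin: "X p (f1 + f2) = X p f1 + X p f2" "X p (f1 * f2) = f1 p * X p f2 + f2 p * X p f1"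
    "X p (c *\<^sub>R f1) = c * X p f1"
    if "smooth_fun A f1" "smooth_fun A f2" for f1 f2 c
    using assms(1) that unfolding vector_fields_def tangent_space_def by blast+
  show "X p (\<lambda>q. f q + h q) = X p f + X p h" "X p (\<lambda>q. f q * h q) = f p * X p h + h p * X p f"
    using lin(1,2)[OF assms(2,3)] by (simp_all add: plus_fun_def times_fun_def)
  show scale: "X p (\<lambda>q. c * f q) = c * X p f"
    using lin(3)[OF assms(2,2), of c] by (simp add: scaleR_fun_def)
  have "smooth_fun A (\<lambda>q. - h q)" "X p (\<lambda>q. - h q) = - X p h"
    using smooth_fun_mult[OF smooth_fun_const assms(3), of "-1"] lin(3)[OF assms(3,3), of "-1"]
    by (simp_all add: scaleR_fun_def)
  then show "X p (\<lambda>q. f q - h q) = X p f - X p h"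
    using lin(1)[OF assms(2), of "\<lambda>q. - h q"] by (simp add: plus_fun_def)
qed

lemma vector_field_const:
  assumes "X \<in> vector_fields A" shows "X p (\<lambda>q. c) = 0"
proof -
  \<comment> \<open>The Leibniz rule for 1 * 1 doubles the value.\<close>
  have "X p (\<lambda>q. 1) = 0"
    using vector_field_derivation(2)[OF assms smooth_fun_const smooth_fun_const, of p 1 1] by simp
  then show ?thesis
    using vector_field_derivation(4)[OF assms smooth_fun_const[of 1] smooth_fun_const, of p c] by simp
qed

lemma vector_fields_add [simp]:
  assumes "X \<in> vector_fields A" "Y \<in> vector_fields A" shows "X + Y \<in> vector_fields A"
  unfolding vector_fields_def mem_Collect_eq
proof (intro conjI allI impI)
  fix f assume "smooth_fun A f"
  then show "smooth_fun A (\<lambda>p. (X + Y) p f)"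
    using smooth_fun_add[OF assms[THEN vector_field_smooth]] by simp
qed (use assms in simp)

lemma vector_fields_fscale [simp]:
  assumes "X \<in> vector_fields A" "smooth_fun A f" shows "fscale f X \<in> vector_fields A"
  unfolding vector_fields_def mem_Collect_eq
proof (intro conjI allI impI)
  fix h assume "smooth_fun A h"
  then show "smooth_fun A (\<lambda>p. fscale f X p h)"
    using smooth_fun_mult[OF assms(2) vector_field_smooth[OF assms(1)]]
    by (simp add: fscale_def scaleR_fun_def)
qed (use assms in \<open>simp add: fscale_def\<close>)

lemma fscale_minus_one: "fscale (\<lambda>_. -1) X = - X"
  by (simp add: fscale_def fun_eq_iff)

lemma vector_fields_minus [simp]: "X \<in> vector_fields A \<Longrightarrow> - X \<in> vector_fields A"
  using vector_fields_fscale[OF _ smooth_fun_const, of X "-1"] by (simp only: fscale_minus_one)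

lemma vector_fields_diff [simp]:
  "X \<in> vector_fields A \<Longrightarrow> Y \<in> vector_fields A \<Longrightarrow> X - Y \<in> vector_fields A"
  using vector_fields_add[OF _ vector_fields_minus, of X Y] by simp

lemma tangent_zero [simp]: "0 \<in> tangent_space A p"
  by (simp add: tangent_space_def)

lemma vector_fields_zero [simp]: "0 \<in> vector_fields A"
  unfolding vector_fields_def mem_Collect_eq
proof (intro conjI allI impI)
  fix f show "smooth_fun A (\<lambda>p. (0 :: 'm vfield) p f)"
    using smooth_fun_const[of 0] by simp
qed simp

lemma lie_bracket_antisym: "lie_bracket Y X = - lie_bracket X Y"
  by (simp add: lie_bracket_def fun_eq_iff)

lemma lie_bracket_add_right:
  assumes "X \<in> vector_fields A" "Y \<in> vector_fields A" "Z \<in> vector_fields A"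
  shows "lie_bracket X (Y + Z) = lie_bracket X Y + lie_bracket X Z"
proof (intro ext)
  fix p f
  show "lie_bracket X (Y + Z) p f = (lie_bracket X Y + lie_bracket X Z) p f"
    \<comment> \<open>For non-smooth \<open>f\<close> the inner functions are constantly 0, and
      \<open>vector_field_const\<close> kills the outer derivatives.\<close>
    by (cases "smooth_fun A f")
      (simp_all add: lie_bracket_def assms[THEN vector_field_derivation(1)]
        assms[THEN vector_field_smooth] assms[THEN vector_field_zero_nonsmooth]
        assms[THEN vector_field_const])
qed

lemma lie_bracket_fscale_right:
  assumes "X \<in> vector_fields A" "Y \<in> vector_fields A" "smooth_fun A h"
  shows "lie_bracket X (fscale h Y) = fscale (\<lambda>p. X p h) Y + fscale h (lie_bracket X Y)"
proof (intro ext)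
  fix p f
  show "lie_bracket X (fscale h Y) p f = (fscale (\<lambda>p. X p h) Y + fscale h (lie_bracket X Y)) p f"
    by (cases "smooth_fun A f")
      (simp_all add: lie_bracket_def fscale_def scaleR_fun_def
        assms(1,2)[THEN vector_field_derivation(2)] assms(3)
        assms(1,2)[THEN vector_field_smooth] assms(1,2)[THEN vector_field_zero_nonsmooth]
        assms(1,2)[THEN vector_field_const] algebra_simps)
qed

lemma lie_bracket_Jacobi:
  assumes "X \<in> vector_fields A" "Y \<in> vector_fields A" "Z \<in> vector_fields A"
  shows "lie_bracket X (lie_bracket Y Z) + lie_bracket Y (lie_bracket Z X)
    + lie_bracket Z (lie_bracket X Y) = 0"
proof (intro ext)
  fix p f
  show "(lie_bracket X (lie_bracket Y Z) + lie_bracket Y (lie_bracket Z X)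
    + lie_bracket Z (lie_bracket X Y)) p f = 0 p f"
    by (cases "smooth_fun A f")
      (simp_all add: lie_bracket_def assms[THEN vector_field_derivation(3)]
        assms[THEN vector_field_smooth] assms[THEN vector_field_zero_nonsmooth]
        assms[THEN vector_field_const])
qed

end

section \<open>Curvature of the Levi-Civita connection\<close>

locale lorentz_mfd = smooth_mfd A
  for A :: "('m::{t2_space, second_countable_topology}, 'n::finite) chart set" +
  fixes g :: "'m tensor02" and D :: "'m conn"
  assumes metric: "lorentzian_metric A g" and levi_civita: "levi_civita A g D"
begin

section \<open>Linear algebra of the metric\<close>

lemma metric_add:
  assumes "u \<in> tangent_space A p" "v \<in> tangent_space A p" "w \<in> tangent_space A p"
  shows "g p (u + v) w = g p u w + g p v w" "g p w (u + v) = g p w u + g p w v"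
  using metric assms unfolding lorentzian_metric_def bilinear_over_def by simp_all

lemma metric_scale:
  assumes "u \<in> tangent_space A p" "w \<in> tangent_space A p"
  shows "g p (c *\<^sub>R u) w = c * g p u w" "g p w (c *\<^sub>R u) = c * g p w u"
  using metric assms unfolding lorentzian_metric_def bilinear_over_def by simp_all

lemma metric_minus:
  assumes "u \<in> tangent_space A p" "v \<in> tangent_space A p"
  shows "g p (- u) v = - g p u v" "g p v (- u) = - g p v u"
  using metric_scale[OF assms, of "-1"] by simp_all

lemma metric_diff:
  assumes "u \<in> tangent_space A p" "v \<in> tangent_space A p" "w \<in> tangent_space A p"
  shows "g p (u - v) w = g p u w - g p v w" "g p w (u - v) = g p w u - g p w v"
  using metric_add[OF assms(1) tangent_minus[OF assms(2)] assms(3)] metric_minus[OF assms(2,3)]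
  by simp_all

lemma metric_zero: "v \<in> tangent_space A p \<Longrightarrow> g p 0 v = 0" "v \<in> tangent_space A p \<Longrightarrow> g p v 0 = 0"
  using metric_scale[of v p v 0] by simp_all

lemmas metric_simps = metric_add metric_scale metric_minus metric_diff metric_zero

lemma metric_sym: "u \<in> tangent_space A p \<Longrightarrow> v \<in> tangent_space A p \<Longrightarrow> g p u v = g p v u"
  using metric unfolding lorentzian_metric_def by blast

lemma pseudo_orthonormal_basis:
  obtains e :: "'n \<Rightarrow> 'm tvec" and k where "inj e" "independent (range e)"
    "span (range e) = tangent_space A p"
    "\<And>i j. g p (e i) (e j) = (if i \<noteq> j then 0 else if i = k then -1 else 1)"
  using metric unfolding lorentzian_metric_def by blast

text \<open>A pseudo-orthonormal basis bounds the dimension of the space of derivations at \<open>p\<close> by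
  \<open>CARD('n)\<close>, so independent fields span it; Hadamard's lemma is not needed.\<close>

lemma vector_field_extension:
  assumes "v \<in> tangent_space A p"
  obtains X where "X \<in> vector_fields A" "X p = v"
proof -
  obtain E :: "'n \<Rightarrow> 'm vfield" where E: "\<And>i. E i \<in> vector_fields A"
    and inj: "inj (\<lambda>i. E i p)" and ind: "independent (range (\<lambda>i. E i p))"
    using independent_vector_fields_exist[of p] by blast
  obtain e :: "'n \<Rightarrow> 'm tvec" where e: "span (range e) = tangent_space A p"
    by (rule pseudo_orthonormal_basis[of p])
  let ?B = "range (\<lambda>i. E i p)"
  have "v \<in> span ?B"
  proof (rule ccontr)
    assume v: "v \<notin> span ?B"
    then have "independent (insert v ?B)"
      using ind by (rule real_vector.independent_insertI)
    moreover have "insert v ?B \<subseteq> span (range e)"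
      using assms E unfolding e by auto
    ultimately have "card (insert v ?B) \<le> card (range e)"
      using real_vector.independent_span_bound[of "range e" "insert v ?B"] by simp
    moreover have "card (insert v ?B) = Suc CARD('n)"
      using v inj real_vector.span_superset[of ?B] by (subst card_insert_disjoint) (auto simp: card_image)
    moreover have "card (range e) \<le> CARD('n)"
      by (rule card_image_le) simp
    ultimately show False by simp
  qed
  then have "\<exists>X\<in>vector_fields A. X p = v"
  proof (induction rule: real_vector.span_induct_alt)
    case base
    show ?case by (rule bexI[of _ 0]) simp_all
  next
    case (step c x y)
    then obtain i Y where "x = E i p" "Y \<in> vector_fields A" "Y p = y" by blast
    moreover from this have "fscale (\<lambda>_. c) (E i) + Y \<in> vector_fields A"
      by (simp add: E smooth_fun_const)
    ultimately show ?case
      by (intro bexI[of _ "fscale (\<lambda>_. c) (E i) + Y"]) (simp_all add: fscale_def)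
  qed
  then show ?thesis using that by blast
qed

lemma metric_sum:
  assumes v: "\<And>i. v i \<in> tangent_space A p" and w: "w \<in> tangent_space A p"
  shows "g p (sum v I) w = (\<Sum>i\<in>I. g p (v i) w)"
proof -
  \<comment> \<open>Tangency of the partial sum joins the induction because
    \<open>metric_add\<close> requires it.\<close>
  have "sum v I \<in> tangent_space A p \<and> g p (sum v I) w = (\<Sum>i\<in>I. g p (v i) w)"
  proof (induction I rule: infinite_finite_induct)
    case (insert i I)
    have "sum v (insert i I) = v i + sum v I"
      using insert.hyps by (rule sum.insert)
    moreover have "(\<Sum>i\<in>insert i I. g p (v i) w) = g p (v i) w + (\<Sum>i\<in>I. g p (v i) w)"
      using insert.hyps by (rule sum.insert)
    ultimately show ?case using insert.IH v w by (metis metric_add(1) tangent_add)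
  qed (metis sum.infinite sum.empty metric_zero(1) w tangent_zero)+
  then show ?thesis by simp
qed

text \<open>Pairing with a pseudo-orthonormal basis vector returns the corresponding coefficient up
  to sign.\<close>

lemma metric_nondegenerate:
  assumes u: "u \<in> tangent_space A p" and "\<And>w. w \<in> tangent_space A p \<Longrightarrow> g p u w = 0"
  shows "u = 0"
proof -
  obtain e :: "'n \<Rightarrow> 'm tvec" and k where e: "inj e" "span (range e) = tangent_space A p"
    and ge: "\<And>i j. g p (e i) (e j) = (if i \<noteq> j then 0 else if i = k then -1 else 1)"
    using pseudo_orthonormal_basis[of p] by metis
  have eT: "e i \<in> tangent_space A p" for i
    using e(2) real_vector.span_superset[of "range e"] by blast
  obtain c where "u = (\<Sum>v\<in>range e. c v *\<^sub>R v)"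
    using u e(2) real_vector.span_finite[of "range e"] by auto
  then have c: "u = (\<Sum>i\<in>UNIV. c (e i) *\<^sub>R e i)"
    by (simp add: sum.reindex[OF e(1)])
  have "g p u (e j) = c (e j) * g p (e j) (e j)" for j
  proof -
    have "g p u (e j) = (\<Sum>i\<in>UNIV. g p (c (e i) *\<^sub>R e i) (e j))"
      unfolding c by (rule metric_sum) (simp_all add: eT)
    also have "\<dots> = (\<Sum>i\<in>UNIV. if i = j then c (e j) * g p (e j) (e j) else 0)"
      by (rule sum.cong) (simp_all add: metric_scale(1)[OF eT eT] ge)
    finally show ?thesis by simp
  qed
  then have "c (e j) = 0" for j
    using assms(2)[OF eT, of j] ge[of j j] by (metis mult_eq_0_iff neg_equal_0_iff_equal one_neq_zero)
  then show ?thesis using c by simp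
qed

lemma tangent_eqI:
  assumes "u \<in> tangent_space A p" "v \<in> tangent_space A p"
    "\<And>w. w \<in> tangent_space A p \<Longrightarrow> g p u w = g p v w"
  shows "u = v"
  using metric_nondegenerate[of "u - v" p] assms by (simp add: metric_simps)

section \<open>The Levi-Civita connection\<close>

lemma smooth_fun_metric [simp]:
  "X \<in> vector_fields A \<Longrightarrow> Y \<in> vector_fields A \<Longrightarrow> smooth_fun A (on_fields g X Y)"
  using metric unfolding lorentzian_metric_def by blast

lemma connection [simp]: "X \<in> vector_fields A \<Longrightarrow> Y \<in> vector_fields A \<Longrightarrow> D X Y \<in> vector_fields A"
  using levi_civita unfolding levi_civita_def linear_connection_def by blast

lemma connection_add:
  assumes "X \<in> vector_fields A" "Y \<in> vector_fields A" "Z \<in> vector_fields A"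
  shows "D (X + Y) Z = D X Z + D Y Z" "D X (Y + Z) = D X Y + D X Z"
  using levi_civita assms unfolding levi_civita_def linear_connection_def by blast+

lemma connection_fscale:
  assumes "X \<in> vector_fields A" "Y \<in> vector_fields A" "smooth_fun A f"
  shows "D (fscale f X) Y = fscale f (D X Y)"
    "D X (fscale f Y) = fscale (\<lambda>p. X p f) Y + fscale f (D X Y)"
  using levi_civita assms unfolding levi_civita_def linear_connection_def by blast+

lemma connection_diff:
  assumes "X \<in> vector_fields A" "Y \<in> vector_fields A" "Z \<in> vector_fields A"
  shows "D (X - Y) Z = D X Z - D Y Z" "D X (Y - Z) = D X Y - D X Z"
  using connection_add(1)[of "X - Y" Y Z] connection_add(2)[of X "Y - Z" Z] assms
  by (simp_all add: algebra_simps)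

lemma torsion_free:
  "X \<in> vector_fields A \<Longrightarrow> Y \<in> vector_fields A \<Longrightarrow> D X Y - D Y X = lie_bracket X Y"
  using levi_civita unfolding levi_civita_def by blast

text \<open>Vanishing torsion writes the bracket as a difference of two covariant derivatives, which
  spares a check of the derivation property.\<close>

lemma lie_bracket [simp]:
  "X \<in> vector_fields A \<Longrightarrow> Y \<in> vector_fields A \<Longrightarrow> lie_bracket X Y \<in> vector_fields A"
  by (simp flip: torsion_free)

lemma metric_compatible:
  assumes "X \<in> vector_fields A" "Y \<in> vector_fields A" "Z \<in> vector_fields A"
  shows "X p (on_fields g Y Z) = on_fields g (D X Y) Z p + on_fields g Y (D X Z) p"
proof -
  have "cov_deriv02 D g X Y Z p = 0"
    using levi_civita assms unfolding levi_civita_def by (metis zero_fun_apply)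
  then show ?thesis by (simp add: cov_deriv02_def)
qed

section \<open>Curvature symmetries and the Bianchi identities\<close>

abbreviation R :: "'m vfield \<Rightarrow> 'm vfield \<Rightarrow> 'm vfield \<Rightarrow> 'm vfield" where
  "R \<equiv> curvature D"

lemma curvature [simp]:
  "X \<in> vector_fields A \<Longrightarrow> Y \<in> vector_fields A \<Longrightarrow> Z \<in> vector_fields A \<Longrightarrow> R X Y Z \<in> vector_fields A"
  by (simp add: curvature_def)

lemma connection_minus:
  assumes "X \<in> vector_fields A" "Y \<in> vector_fields A"
  shows "D (- X) Y = - D X Y" "D X (- Y) = - D X Y"
  using connection_diff(1)[of 0 X Y] connection_diff(1)[of X X Y]
    connection_diff(2)[of X 0 Y] connection_diff(2)[of X Y Y] assms by simp_all

lemma curvature_antisym: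
  assumes "X \<in> vector_fields A" "Y \<in> vector_fields A" "Z \<in> vector_fields A"
  shows "R Y X Z = - R X Y Z"
  using assms by (simp add: curvature_def lie_bracket_antisym[of Y X] connection_minus)

lemma curvature_add:
  assumes "X \<in> vector_fields A" "Y \<in> vector_fields A" "Y' \<in> vector_fields A" "Z \<in> vector_fields A"
  shows "R X (Y + Y') Z = R X Y Z + R X Y' Z"
  using assms by (simp add: curvature_def lie_bracket_add_right connection_add algebra_simps)

lemma curvature_diff:
  assumes "X \<in> vector_fields A" "Y \<in> vector_fields A" "Y' \<in> vector_fields A" "Z \<in> vector_fields A"
  shows "R X (Y - Y') Z = R X Y Z - R X Y' Z"
  using curvature_add[of X "Y - Y'" Y' Z] assms by (simp add: algebra_simps)

text \<open>The term (X f) D_Y Z from differentiating f D_Y Z cancels against the one from [X, f Y].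
  This slot is the one needed for \<open>R Y (D X \<xi>) Z\<close>, where \<open>D X \<xi>\<close>
  has function coefficients.\<close>

lemma curvature_fscale:
  assumes "X \<in> vector_fields A" "Y \<in> vector_fields A" "Z \<in> vector_fields A" "smooth_fun A f"
  shows "R X (fscale f Y) Z = fscale f (R X Y Z)"
  using assms
  by (simp add: curvature_def lie_bracket_fscale_right connection_add connection_fscale vector_field_smooth)
    (simp add: fscale_def fun_eq_iff algebra_simps)

text \<open>Regrouping the second derivatives and using vanishing torsion twice produces nested
  brackets, which sum to 0 by Jacobi.\<close>

lemma Bianchi_first:
  assumes "X \<in> vector_fields A" "Y \<in> vector_fields A" "Z \<in> vector_fields A"
  shows "R X Y Z + R Y Z X + R Z X Y = 0"
proof -
  have "R X Y Z + R Y Z X + R Z X Y = (D X (D Y Z - D Z Y) - D (lie_bracket Y Z) X)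
     + (D Y (D Z X - D X Z) - D (lie_bracket Z X) Y) + (D Z (D X Y - D Y X) - D (lie_bracket X Y) Z)"
    using assms by (simp add: curvature_def connection_diff algebra_simps)
  also have "\<dots> = lie_bracket X (lie_bracket Y Z) + lie_bracket Y (lie_bracket Z X)
     + lie_bracket Z (lie_bracket X Y)"
    using assms by (simp add: torsion_free)
  finally show ?thesis using lie_bracket_Jacobi[OF assms] by simp
qed

lemma on_fields_metric_sym:
  "X \<in> vector_fields A \<Longrightarrow> Y \<in> vector_fields A \<Longrightarrow> on_fields g X Y p = on_fields g Y X p"
  by (simp add: on_fields_def metric_sym)

lemma on_fields_metric_diff:
  assumes "X \<in> vector_fields A" "Y \<in> vector_fields A" "Z \<in> vector_fields A"
  shows "on_fields g (X - Y) Z p = on_fields g X Z p - on_fields g Y Z p"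
    "on_fields g X (Y - Z) p = on_fields g X Y p - on_fields g X Z p"
  using assms by (simp_all add: on_fields_def metric_simps)

text \<open>Apply [X,Y] to g(Z,W) in two ways. The mixed terms g(D_Y Z, D_X W) + g(D_X Z, D_Y W) are
  symmetric in X and Y and drop out of the commutator.\<close>

lemma curvature_skew:
  assumes "X \<in> vector_fields A" "Y \<in> vector_fields A" "Z \<in> vector_fields A" "W \<in> vector_fields A"
  shows "on_fields g (R X Y Z) W p = - on_fields g (R X Y W) Z p"
proof -
  have second: "X p (\<lambda>q. Y q (on_fields g Z W)) = on_fields g (D X (D Y Z)) W p
      + on_fields g (D Y Z) (D X W) p + on_fields g (D X Z) (D Y W) p + on_fields g Z (D X (D Y W)) p"
    if "X \<in> vector_fields A" "Y \<in> vector_fields A" for X Y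
    using that assms(3,4)
    by (simp add: metric_compatible vector_field_derivation(1)[OF that(1)])
  have "lie_bracket X Y p (on_fields g Z W)
      = X p (\<lambda>q. Y q (on_fields g Z W)) - Y p (\<lambda>q. X q (on_fields g Z W))"
    by (simp add: lie_bracket_def)
  then show ?thesis
    using assms on_fields_metric_sym[of "R X Y W" Z p]
    by (simp add: second metric_compatible[of "lie_bracket X Y"] curvature_def on_fields_metric_diff)
qed

text \<open>The usual octahedron argument: four cyclic identities combined with skewness in each
  pair form a linear system with this consequence.\<close>

lemma curvature_pair_sym:
  assumes "X \<in> vector_fields A" "Y \<in> vector_fields A" "Z \<in> vector_fields A" "W \<in> vector_fields A"
  shows "on_fields g (R X Y Z) W p = on_fields g (R Z W X) Y p"
proof -
  let ?r = "\<lambda>X Y Z W. on_fields g (R X Y Z) W p"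
  have anti: "?r Y X Z W = - ?r X Y Z W"
    if "X \<in> vector_fields A" "Y \<in> vector_fields A" "Z \<in> vector_fields A" "W \<in> vector_fields A" for X Y Z W
    using that by (simp add: curvature_antisym[of X Y] on_fields_def metric_simps)
  have cyc: "?r X Y Z W + ?r Y Z X W + ?r Z X Y W = 0"
    if "X \<in> vector_fields A" "Y \<in> vector_fields A" "Z \<in> vector_fields A" "W \<in> vector_fields A" for X Y Z W
  proof -
    have "?r X Y Z W + ?r Y Z X W + ?r Z X Y W = on_fields g (R X Y Z + R Y Z X + R Z X Y) W p"
      using that by (simp add: on_fields_def metric_simps)
    then show ?thesis
      using that by (simp only: Bianchi_first) (simp add: on_fields_def metric_simps)
  qed
  note skew = curvature_skew[where p = p]
  show ?thesis
    using cyc[OF assms] cyc[OF assms(2,3,4,1)] cyc[OF assms(3,4,1,2)] cyc[OF assms(4,1,2,3)]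
      skew[OF assms(1,2,3,4)] skew[OF assms(2,3,1,4)] skew[OF assms(3,1,2,4)]
      skew[OF assms(2,3,4,1)] skew[OF assms(3,4,2,1)] skew[OF assms(4,2,3,1)]
      skew[OF assms(3,4,1,2)] skew[OF assms(4,1,3,2)] skew[OF assms(1,3,4,2)]
      skew[OF assms(4,1,2,3)] skew[OF assms(1,2,4,3)] skew[OF assms(2,4,1,3)]
      anti[OF assms(1,2,3,4)] anti[OF assms(1,3,2,4)] anti[OF assms(1,3,4,2)]
      anti[OF assms(2,4,1,3)] anti[OF assms(2,4,3,1)]
    by linarith
qed

text \<open>Vanishing torsion merges the slot terms into R([X,Y],Z)W and its cyclic images. What
  remains is the Jacobi identity for the operators D_X, D_Y, D_Z together with that for the
  fields.\<close>

lemma Bianchi_second: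
  assumes "X \<in> vector_fields A" "Y \<in> vector_fields A" "Z \<in> vector_fields A" "W \<in> vector_fields A"
  shows "cov_deriv13 D R X Y Z W + cov_deriv13 D R Y Z X W + cov_deriv13 D R Z X Y W = 0"
proof -
  have slots: "R (D X Y) Z W + R Z (D Y X) W = R (lie_bracket X Y) Z W"
    if "X \<in> vector_fields A" "Y \<in> vector_fields A" "Z \<in> vector_fields A" for X Y Z
  proof -
    have "R (D X Y) Z W + R Z (D Y X) W = - (R Z (D X Y - D Y X) W)"
      using that assms(4) curvature_antisym[of Z "D X Y" W] by (simp add: curvature_diff)
    also have "\<dots> = R (lie_bracket X Y) Z W"
      using that assms(4) curvature_antisym[of Z "lie_bracket X Y" W] by (simp add: torsion_free)
    finally show ?thesis .
  qed
  have jac: "D (lie_bracket (lie_bracket X Y) Z) W + D (lie_bracket (lie_bracket Y Z) X) W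
      + D (lie_bracket (lie_bracket Z X) Y) W = 0"
  proof -
    have "D (lie_bracket (lie_bracket X Y) Z) W + D (lie_bracket (lie_bracket Y Z) X) W
      + D (lie_bracket (lie_bracket Z X) Y) W
      = D (- (lie_bracket X (lie_bracket Y Z) + lie_bracket Y (lie_bracket Z X)
          + lie_bracket Z (lie_bracket X Y))) W"
      using assms lie_bracket_antisym[of "lie_bracket X Y" Z] lie_bracket_antisym[of "lie_bracket Y Z" X]
        lie_bracket_antisym[of "lie_bracket Z X" Y]
      by (simp add: connection_minus connection_add connection_diff del: minus_add_distrib)
    \<comment> \<open>The zero field is written as a difference so that
      \<open>connection_diff\<close> applies.\<close>
    also have "\<dots> = D (W - W) W"
      using lie_bracket_Jacobi[OF assms(1-3)] by simp
    also have "\<dots> = 0"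
      using assms(4) by (simp only: connection_diff) simp
    finally show ?thesis .
  qed
  have "cov_deriv13 D R X Y Z W + cov_deriv13 D R Y Z X W + cov_deriv13 D R Z X Y W
    = (D X (R Y Z W) - R Y Z (D X W)) + (D Y (R Z X W) - R Z X (D Y W)) + (D Z (R X Y W) - R X Y (D Z W))
      - (R (lie_bracket X Y) Z W + R (lie_bracket Y Z) X W + R (lie_bracket Z X) Y W)"
    using assms by (simp add: cov_deriv13_def flip: slots)
  also have "\<dots> = 0"
    using assms jac by (simp add: curvature_def connection_diff add.assoc)
  finally show ?thesis .
qed

end

lemma real_vector_eq_minus_self:
  fixes a :: "'v :: real_vector"
  assumes "a = - a" shows "a = 0"
  using assms by (metis add.right_inverse scaleR_2 scaleR_eq_0_iff zero_neq_numeral)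

section \<open>Homogeneous structures of type T1 + T3\<close>

locale homogeneous_T1_T3 = lorentz_mfd A g D
  for A :: "('m::{t2_space, second_countable_topology}, 'n::finite) chart set"
    and g :: "'m tensor02" and D :: "'m conn" +
  fixes S T :: "'m tensor12" and \<xi> :: "'m vfield"
  assumes homog: "homogeneous_structure A g D S"
    and decomposition: "T1_T3_decomposition A g S \<xi> T"
    and nonnull: "\<And>p. g p (\<xi> p) (\<xi> p) \<noteq> 0"
    and dim_ge_2: "CARD('n) \<ge> 2"
begin

section \<open>Pointwise algebra of \<open>S\<close> and \<open>T\<close>\<close>

lemma xi [simp]: "\<xi> \<in> vector_fields A"
  using decomposition unfolding T1_T3_decomposition_def by blast

lemma tensor_fields: "tensor12_field A S" "tensor12_field A T"
  using homog decomposition unfolding homogeneous_structure_def T1_T3_decomposition_def by blast+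

lemma tensor_closed [simp]:
  "u \<in> tangent_space A p \<Longrightarrow> v \<in> tangent_space A p \<Longrightarrow> T p u v \<in> tangent_space A p"
  "u \<in> tangent_space A p \<Longrightarrow> v \<in> tangent_space A p \<Longrightarrow> S p u v \<in> tangent_space A p"
  "X \<in> vector_fields A \<Longrightarrow> Y \<in> vector_fields A \<Longrightarrow> on_fields S X Y \<in> vector_fields A"
  using tensor_fields unfolding tensor12_field_def by blast+

lemma S_eq:
  "u \<in> tangent_space A p \<Longrightarrow> v \<in> tangent_space A p \<Longrightarrow>
    S p u v = T p u v + g p u v *\<^sub>R \<xi> p - g p (\<xi> p) v *\<^sub>R u"
  using decomposition unfolding T1_T3_decomposition_def by blast

lemma T_add:
  assumes "u \<in> tangent_space A p" "v \<in> tangent_space A p" "w \<in> tangent_space A p"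
  shows "T p (u + v) w = T p u w + T p v w" "T p w (u + v) = T p w u + T p w v"
  using tensor_fields(2) assms unfolding tensor12_field_def bilinear_over_def by blast+

lemma T_scale:
  assumes "u \<in> tangent_space A p" "w \<in> tangent_space A p"
  shows "T p (c *\<^sub>R u) w = c *\<^sub>R T p u w" "T p w (c *\<^sub>R u) = c *\<^sub>R T p w u"
  using tensor_fields(2) assms unfolding tensor12_field_def bilinear_over_def by blast+

lemma T_minus:
  assumes "u \<in> tangent_space A p" "v \<in> tangent_space A p"
  shows "T p (- u) v = - T p u v" "T p v (- u) = - T p v u"
  using T_scale[OF assms, of "-1"] by simp_all

lemma T_diff:
  assumes "u \<in> tangent_space A p" "v \<in> tangent_space A p" "w \<in> tangent_space A p"
  shows "T p (u - v) w = T p u w - T p v w" "T p w (u - v) = T p w u - T p w v"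
  using T_add[OF assms(1) tangent_minus[OF assms(2)] assms(3)] T_minus[OF assms(2,3)]
  by simp_all

lemmas T_simps = T_add T_scale T_minus T_diff

lemma T_skew:
  assumes "u \<in> tangent_space A p" "v \<in> tangent_space A p" "w \<in> tangent_space A p"
  shows "g p (T p u v) w = - g p (T p v u) w" "g p (T p u v) w = - g p (T p u w) v"
  using decomposition assms unfolding T1_T3_decomposition_def by blast+

lemma T_antisym:
  assumes "u \<in> tangent_space A p" "v \<in> tangent_space A p"
  shows "T p u v = - T p v u"
proof (rule tangent_eqI[of _ p])
  fix w assume "w \<in> tangent_space A p"
  then show "g p (T p u v) w = g p (- T p v u) w"
    using T_skew(1)[OF assms] assms by (simp add: metric_minus)
qed (use assms in simp_all)

lemma T_self:
  assumes "u \<in> tangent_space A p"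
  shows "T p u u = 0"
  using T_antisym[OF assms assms] by (rule real_vector_eq_minus_self)

section \<open>The connection making g, R and \<open>S\<close> parallel\<close>

definition Dbar :: "'m conn" where
  "Dbar X Y = D X Y - on_fields S X Y"

lemma Dbar [simp]: "X \<in> vector_fields A \<Longrightarrow> Y \<in> vector_fields A \<Longrightarrow> Dbar X Y \<in> vector_fields A"
  by (simp add: Dbar_def)

lemma Dbar_parallel:
  assumes "X \<in> vector_fields A" "Y \<in> vector_fields A" "Z \<in> vector_fields A"
  shows "X p (on_fields g Y Z) = on_fields g (Dbar X Y) Z p + on_fields g Y (Dbar X Z) p"
    "Dbar X (on_fields S Y Z) = on_fields S (Dbar X Y) Z + on_fields S Y (Dbar X Z)"
    "W \<in> vector_fields A \<Longrightarrow> cov_deriv13 Dbar R X Y Z W = 0"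
proof -
  have Dbar: "(\<lambda>X Y. D X Y - on_fields S X Y) = Dbar"
    by (simp add: Dbar_def[abs_def])
  have par: "cov_deriv02 Dbar g X Y Z = 0" "cov_deriv12 Dbar S X Y Z = 0"
    "W \<in> vector_fields A \<Longrightarrow> cov_deriv13 Dbar R X Y Z W = 0"
    using homog assms unfolding homogeneous_structure_def Dbar Let_def by blast+
  then show "W \<in> vector_fields A \<Longrightarrow> cov_deriv13 Dbar R X Y Z W = 0" by simp
  have "cov_deriv02 Dbar g X Y Z p = 0"
    using par(1) by simp
  then show "X p (on_fields g Y Z) = on_fields g (Dbar X Y) Z p + on_fields g Y (Dbar X Z) p"
    by (simp add: cov_deriv02_def)
  show "Dbar X (on_fields S Y Z) = on_fields S (Dbar X Y) Z + on_fields S Y (Dbar X Z)"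
    using par(2) by (simp add: cov_deriv12_def algebra_simps)
qed

lemma on_fields_apply: "on_fields t X Y p = t p (X p) (Y p)"
  by (simp add: on_fields_def)

lemma fscale_apply: "fscale f X p = f p *\<^sub>R X p"
  by (simp add: fscale_def)

lemma S_diff:
  assumes "u \<in> tangent_space A p" "v \<in> tangent_space A p" "w \<in> tangent_space A p"
  shows "S p (u - v) w = S p u w - S p v w" "S p w (u - v) = S p w u - S p w v"
  using assms by (simp_all add: S_eq T_simps metric_simps algebra_simps)

lemma S_add_left:
  assumes "u \<in> tangent_space A p" "v \<in> tangent_space A p" "w \<in> tangent_space A p"
  shows "S p (u + v) w = S p u w + S p v w"
  using assms by (simp add: S_eq T_simps metric_simps algebra_simps)

lemma S_scale_right:
  assumes "u \<in> tangent_space A p" "w \<in> tangent_space A p"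
  shows "S p w (c *\<^sub>R u) = c *\<^sub>R S p w u"
  using assms by (simp add: S_eq T_simps metric_simps algebra_simps)

lemma S_zero: "u \<in> tangent_space A p \<Longrightarrow> S p u 0 = 0"
  using S_scale_right[of u p u 0] by simp

lemmas S_simps = S_diff S_add_left S_scale_right

section \<open>Parallelism of \<xi>\<close>

lemma Dbar_diff_right:
  assumes "X \<in> vector_fields A" "Y \<in> vector_fields A" "Z \<in> vector_fields A"
  shows "Dbar X (Y - Z) p = Dbar X Y p - Dbar X Z p"
  using assms by (simp add: Dbar_def connection_diff on_fields_apply S_simps)

lemma Dbar_fscale_right:
  assumes "X \<in> vector_fields A" "Y \<in> vector_fields A" "smooth_fun A f"
  shows "Dbar X (fscale f Y) p = X p f *\<^sub>R Y p + f p *\<^sub>R Dbar X Y p"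
  using assms
  by (simp add: Dbar_def connection_fscale on_fields_apply fscale_apply S_simps scaleR_diff_right)

text \<open>Restricted to the diagonal, the parallelism of \<open>S\<close> no longer involves \<open>T\<close>.\<close>

lemma Dbar_xi_diagonal:
  assumes V: "V \<in> vector_fields A" and u: "u \<in> tangent_space A p"
  shows "g p u u *\<^sub>R Dbar V \<xi> p = g p (Dbar V \<xi> p) u *\<^sub>R u"
proof -
  obtain X where X: "X \<in> vector_fields A" "X p = u"
    using vector_field_extension[OF u] .
  let ?U = "Dbar V X"
  have diag: "on_fields S X X = fscale (on_fields g X X) \<xi> - fscale (on_fields g \<xi> X) X"
    by (rule ext) (simp add: on_fields_apply fscale_apply S_eq T_self X)
  have "Dbar V (on_fields S X X) p = S p (?U p) u + S p u (?U p)"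
    using Dbar_parallel(2)[OF V X(1) X(1)] X(2) by (simp add: on_fields_apply)
  \<comment> \<open>The two contributions of \<open>T\<close> are T(U,u) and T(u,U), which
    cancel.\<close>
  also have "\<dots> = (2 * g p (?U p) u) *\<^sub>R \<xi> p - g p (\<xi> p) u *\<^sub>R ?U p - g p (\<xi> p) (?U p) *\<^sub>R u"
    using u V X(1) T_antisym[of u p "?U p"] metric_sym[of u p "?U p"]
    by (simp add: S_eq scaleR_2 flip: scaleR_scaleR)
  finally have "(2 * g p (?U p) u) *\<^sub>R \<xi> p - g p (\<xi> p) u *\<^sub>R ?U p - g p (\<xi> p) (?U p) *\<^sub>R u
      = Dbar V (fscale (on_fields g X X) \<xi>) p - Dbar V (fscale (on_fields g \<xi> X) X) p"
    using V X(1) by (simp add: diag Dbar_diff_right)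
  also have "\<dots> = (2 * g p (?U p) u) *\<^sub>R \<xi> p + g p u u *\<^sub>R Dbar V \<xi> p
      - (g p (Dbar V \<xi> p) u + g p (\<xi> p) (?U p)) *\<^sub>R u - g p (\<xi> p) u *\<^sub>R ?U p"
    using V X metric_sym[of u p "?U p"] u
    by (simp add: Dbar_fscale_right Dbar_parallel(1) on_fields_apply)
  \<comment> \<open>All terms containing \<open>?U\<close> occur on both sides; only derivatives of
    \<xi> survive.\<close>
  finally show ?thesis by (simp add: scaleR_add_left)
qed

text \<open>Two basis vectors are combined so that their pairings with \<open>x\<close> cancel. The
  vector \<open>z\<close> certifies that \<open>w\<close> is nonzero, since \<open>w\<close> itself
  may be null.\<close>

lemma orthogonal_vector_exists:
  assumes x: "x \<in> tangent_space A p"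
  obtains w z where "w \<in> tangent_space A p" "z \<in> tangent_space A p" "g p x w = 0" "g p w z \<noteq> 0"
proof -
  obtain e :: "'n \<Rightarrow> 'm tvec" and k where e: "span (range e) = tangent_space A p"
    and ge: "\<And>i j. g p (e i) (e j) = (if i \<noteq> j then 0 else if i = k then -1 else 1)"
    using pseudo_orthonormal_basis[of p] by metis
  have eT [simp]: "e i \<in> tangent_space A p" for i
    using e real_vector.span_superset[of "range e"] by blast
  obtain i j :: 'n where "i \<noteq> j"
    using dim_ge_2 card_le_Suc0_iff_eq[of "UNIV :: 'n set"] by force
  show ?thesis
  proof (cases "g p x (e i) = 0")
    case True
    then show ?thesis using ge[of i i] by (intro that[of "e i" "e i"]) (auto split: if_splits)
  next
    case False
    let ?w = "g p x (e j) *\<^sub>R e i - g p x (e i) *\<^sub>R e j"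
    have "g p ?w (e j) = - (g p x (e i) * g p (e j) (e j))"
      using ge[of i j] \<open>i \<noteq> j\<close> by (simp add: metric_simps)
    moreover have "g p x ?w = 0"
      using x by (simp add: metric_simps)
    moreover have "g p (e j) (e j) \<noteq> 0" using ge[of j j] by simp
    ultimately show ?thesis using False by (intro that[of ?w "e j"]) simp_all
  qed
qed

text \<open>By \<open>Dbar_xi_diagonal\<close> the vector \<eta> is proportional to every non-null
  vector. Testing \<xi>, a nonzero \<open>w\<close> orthogonal to \<xi>, and their sum shows that
  this is impossible unless \<eta> = 0.\<close>

lemma Dbar_xi:
  assumes V: "V \<in> vector_fields A"
  shows "Dbar V \<xi> p = 0"
proof (rule metric_nondegenerate)
  show \<eta>: "Dbar V \<xi> p \<in> tangent_space A p" using V by simp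
  let ?\<eta> = "Dbar V \<xi> p" and ?x = "\<xi> p"
  have x: "?x \<in> tangent_space A p" by simp
  have pair: "g p u u * g p ?\<eta> z = g p ?\<eta> u * g p u z"
    if "u \<in> tangent_space A p" "z \<in> tangent_space A p" for u z
    using arg_cong[OF Dbar_xi_diagonal[OF V that(1)], of "\<lambda>y. g p y z"] that \<eta>
    by (simp add: metric_simps)
  obtain w z where wz: "w \<in> tangent_space A p" "z \<in> tangent_space A p"
      "g p ?x w = 0" "g p w z \<noteq> 0"
    by (rule orthogonal_vector_exists[OF x])
  have \<eta>w: "g p ?\<eta> w = 0"
    using pair[OF x wz(1)] wz(3) nonnull[of p] by simp
  have wx: "g p w ?x = 0"
    using wz(1,3) x by (simp add: metric_sym)
  \<comment> \<open>Subtracting the identities for \<xi> and for \<open>w\<close> from the one for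
    their sum leaves the cross term g(\<eta>,\<xi>) g(w,z).\<close>
  have "(g p ?x ?x + g p w w) * g p ?\<eta> z = g p ?\<eta> ?x * (g p ?x z + g p w z)"
    using pair[of "?x + w" z] wz x \<eta> \<eta>w wx by (simp add: metric_simps)
  then have "g p ?\<eta> ?x * g p w z = 0"
    using pair[OF x wz(2)] pair[OF wz(1,2)] \<eta>w by (simp add: algebra_simps)
  then have "g p ?\<eta> ?x = 0" using wz(4) by simp
  then show "g p ?\<eta> z = 0" if "z \<in> tangent_space A p" for z
    using pair[OF x that] nonnull[of p] by simp
qed

lemma Dbar_xi_eq: "V \<in> vector_fields A \<Longrightarrow> Dbar V \<xi> = 0"
  by (rule ext) (simp add: Dbar_xi)

text \<open>Consequently \<kappa> passes through covariant derivatives like a constant, although it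
  is kept as a function.\<close>

lemma norm_xi_constant:
  assumes "V \<in> vector_fields A"
  shows "V p (on_fields g \<xi> \<xi>) = 0"
  using Dbar_parallel(1)[OF assms xi xi, of p] assms
  by (simp add: on_fields_apply Dbar_xi metric_zero)

section \<open>Curvature applied to \<xi>\<close>

lemma connection_xi: "V \<in> vector_fields A \<Longrightarrow> D V \<xi> = on_fields S V \<xi>"
  using Dbar_xi_eq[of V] by (simp add: Dbar_def)

text \<open>As \<open>S\<close> and \<xi> are parallel for \<open>Dbar\<close>, differentiating D_Y
  \<xi> = S_Y \<xi> yields no derivative of \<open>S\<close>. The terms with \<open>Dbar X Y\<close>
  and \<open>Dbar Y X\<close> cancel against the bracket, leaving the torsion of
  \<open>Dbar\<close>, which is purely algebraic in \<open>S\<close>.\<close>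

lemma curvature_xi:
  assumes X: "X \<in> vector_fields A" and Y: "Y \<in> vector_fields A"
  shows "R X Y \<xi> p = S p (X p) (S p (Y p) (\<xi> p)) - S p (Y p) (S p (X p) (\<xi> p))
    - S p (S p (X p) (Y p) - S p (Y p) (X p)) (\<xi> p)"
proof -
  have DD: "D X (D Y \<xi>) p = S p (Dbar X Y p) (\<xi> p) + S p (X p) (S p (Y p) (\<xi> p))"
    if "X \<in> vector_fields A" "Y \<in> vector_fields A" for X Y
  proof -
    have "Dbar X (on_fields S Y \<xi>) p = S p (Dbar X Y p) (\<xi> p)"
      using that Dbar_parallel(2)[OF that xi] by (simp add: on_fields_apply Dbar_xi S_zero)
    then show ?thesis
      using that by (simp add: connection_xi Dbar_def on_fields_apply algebra_simps)
  qed
  have "lie_bracket X Y p = (Dbar X Y p - Dbar Y X p) + (S p (X p) (Y p) - S p (Y p) (X p))"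
    using X Y by (simp add: Dbar_def on_fields_apply flip: torsion_free)
  then have "D (lie_bracket X Y) \<xi> p = S p (Dbar X Y p) (\<xi> p) - S p (Dbar Y X p) (\<xi> p)
      + S p (S p (X p) (Y p) - S p (Y p) (X p)) (\<xi> p)"
    using X Y by (simp add: connection_xi on_fields_apply S_simps)
  then show ?thesis
    using X Y by (simp add: curvature_def DD)
qed

text \<open>The Jacobi operator of \<open>\<xi>\<close> is symmetric, while its skew part is a multiple of \<open>T p (\<xi> p)\<close>.\<close>

lemma T_xi:
  assumes u: "u \<in> tangent_space A p"
  shows "T p (\<xi> p) u = 0"
proof (rule metric_nondegenerate)
  let ?x = "\<xi> p" and ?\<Phi> = "T p (\<xi> p)" and ?\<kappa> = "g p (\<xi> p) (\<xi> p)"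
  have x: "?x \<in> tangent_space A p" by simp
  have x\<Phi>: "g p ?x (?\<Phi> u) = 0" if "u \<in> tangent_space A p" for u
    using T_skew(2)[OF x that x] T_self[OF x] that by (simp add: metric_sym metric_zero)
  have jac: "R X \<xi> \<xi> p = - ?\<Phi> (?\<Phi> (X p)) - (2 * ?\<kappa>) *\<^sub>R ?\<Phi> (X p)
      + (?\<kappa> * g p (X p) ?x) *\<^sub>R ?x - (?\<kappa> * ?\<kappa>) *\<^sub>R X p"
    if X: "X \<in> vector_fields A" for X
  proof -
    define u where "u = X p"
    have u: "u \<in> tangent_space A p" using X by (simp add: u_def)
    \<comment> \<open>This is S_u \<xi> - S_\<xi> u, the torsion argument in
      \<open>curvature_xi\<close>; both summands contribute - \<Phi> u, hence the factor -2.\<close>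
    let ?U = "(- 2) *\<^sub>R ?\<Phi> u + g p u ?x *\<^sub>R ?x - ?\<kappa> *\<^sub>R u"
    \<comment> \<open>Collecting terms is done in an arbitrary vector space, with a, b, y, z
      standing for \<Phi>(\<Phi> u), \<Phi> u, \<xi>, u and k, c for \<kappa>, g(u,\<xi>).\<close>
    have combine: "- (- a - k *\<^sub>R b) - (- ((- 2) *\<^sub>R a - k *\<^sub>R b) + 0 *\<^sub>R y
          - k *\<^sub>R ((- 2) *\<^sub>R b + c *\<^sub>R y - k *\<^sub>R z))
        = - a - (2 * k) *\<^sub>R b + (k * c) *\<^sub>R y - (k * k) *\<^sub>R z"
      for a b y z :: "'v :: real_vector" and k c :: real
      by (simp add: algebra_simps scaleR_2, simp only: mult_2_right scaleR_add_left)
    have Sux: "S p v ?x = - ?\<Phi> v + g p v ?x *\<^sub>R ?x - ?\<kappa> *\<^sub>R v" if "v \<in> tangent_space A p" for v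
      using that T_antisym[OF that x] by (simp add: S_eq)
    have Sxu: "S p ?x v = ?\<Phi> v" if "v \<in> tangent_space A p" for v
      using that by (simp add: S_eq)
    have "R X \<xi> \<xi> p = - ?\<Phi> (S p u ?x) - S p (S p u ?x - ?\<Phi> u) ?x"
      using u by (simp add: curvature_xi[OF X xi] u_def[symmetric] Sxu T_self S_zero)
    also have "S p u ?x - ?\<Phi> u = ?U"
      using u by (simp add: Sux scaleR_2)
    also have "S p ?U ?x = - ?\<Phi> ?U + g p ?U ?x *\<^sub>R ?x - ?\<kappa> *\<^sub>R ?U"
      using u by (intro Sux) simp
    also have "?\<Phi> ?U = (- 2) *\<^sub>R ?\<Phi> (?\<Phi> u) - ?\<kappa> *\<^sub>R ?\<Phi> u"
      using u by (simp add: T_simps T_self del: scaleR_minus_left)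
    also have "g p ?U ?x = 0"
      using u metric_sym[of "?\<Phi> u" p ?x] by (simp add: metric_simps x\<Phi>)
    also have "?\<Phi> (S p u ?x) = - ?\<Phi> (?\<Phi> u) - ?\<kappa> *\<^sub>R ?\<Phi> u"
      using u by (simp add: Sux T_simps T_self)
    finally show ?thesis unfolding u_def by (simp only: combine)
  qed
  show "?\<Phi> u \<in> tangent_space A p" using u by simp
  fix v assume v: "v \<in> tangent_space A p"
  obtain X where X: "X \<in> vector_fields A" "X p = u" using vector_field_extension[OF u] .
  obtain Y where Y: "Y \<in> vector_fields A" "Y p = v" using vector_field_extension[OF v] .
  have "g p (R X \<xi> \<xi> p) v = g p (R Y \<xi> \<xi> p) u"
  proof -
    have "on_fields g (R X \<xi> \<xi>) Y p = on_fields g (R \<xi> Y X) \<xi> p"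
      using X(1) Y(1) by (simp add: curvature_pair_sym[of X \<xi> \<xi> Y])
    also have "\<dots> = - on_fields g (R \<xi> Y \<xi>) X p"
      using X(1) Y(1) by (simp add: curvature_skew[of \<xi> Y X \<xi>])
    also have "\<dots> = on_fields g (R Y \<xi> \<xi>) X p"
      using X(1) Y(1) by (simp add: curvature_antisym[of Y \<xi> \<xi>] on_fields_apply metric_minus)
    finally show ?thesis using X(2) Y(2) by (simp add: on_fields_apply)
  qed
  moreover have "g p (?\<Phi> (?\<Phi> u)) v = g p (?\<Phi> (?\<Phi> v)) u"
    using T_skew(2)[of ?x p "?\<Phi> u" v] T_skew(2)[of ?x p "?\<Phi> v" u] u v
      metric_sym[of "?\<Phi> u" p "?\<Phi> v"] by simp
  moreover have "g p (?\<Phi> v) u = - g p (?\<Phi> u) v"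
    using T_skew(2)[OF x v u] .
  \<comment> \<open>All terms of the Jacobi operator except -2 \<kappa> \<Phi> are symmetric, so
    comparison gives -2 \<kappa> g(\<Phi> u, v) = 2 \<kappa> g(\<Phi> u, v).\<close>
  ultimately have "?\<kappa> * g p (?\<Phi> u) v = 0"
    using u v X(2) Y(2) metric_sym[OF u v] metric_sym[OF u x] metric_sym[OF v x]
    by (simp add: jac[OF X(1)] jac[OF Y(1)] metric_simps)
  then show "g p (?\<Phi> u) v = 0" using nonnull[of p] by simp
qed

section \<open>Reduction to constant curvature\<close>

abbreviation \<kappa> :: "'m \<Rightarrow> real" where
  "\<kappa> \<equiv> on_fields g \<xi> \<xi>"

lemma S_xi_left: "u \<in> tangent_space A p \<Longrightarrow> S p (\<xi> p) u = 0"
  by (simp add: S_eq T_xi)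

lemma S_xi_right:
  "u \<in> tangent_space A p \<Longrightarrow> S p u (\<xi> p) = g p u (\<xi> p) *\<^sub>R \<xi> p - \<kappa> p *\<^sub>R u"
  using T_antisym[of u p "\<xi> p"] by (simp add: S_eq T_xi on_fields_apply)

lemma connection_xi_eq:
  assumes "X \<in> vector_fields A"
  shows "D X \<xi> = fscale (on_fields g X \<xi>) \<xi> - fscale \<kappa> X"
  by (rule ext) (use assms in \<open>simp add: connection_xi on_fields_apply[of S] S_xi_right fscale_apply
    on_fields_apply[of g X]\<close>)

text \<open>The vector W = S_X Y - S_Y X is orthogonal to \<xi>, its \<open>T\<close> part because
  T_\<xi> = 0. Hence S_W \<xi> = -\<kappa> W, and this cancels everything in the commutator that
  still involves \<open>T\<close>.\<close>

lemma curvature_xi_eq: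
  assumes X: "X \<in> vector_fields A" and Y: "Y \<in> vector_fields A"
  shows "R X Y \<xi> p = \<kappa> p *\<^sub>R (g p (X p) (\<xi> p) *\<^sub>R Y p - g p (Y p) (\<xi> p) *\<^sub>R X p)"
proof -
  let ?x = "\<xi> p" and ?W = "S p (X p) (Y p) - S p (Y p) (X p)"
  have T: "g p (T p u v) ?x = 0" if "u \<in> tangent_space A p" "v \<in> tangent_space A p" for u v
    using T_skew(2)[OF that, of ?x] T_antisym[of u p ?x] that by (simp add: T_xi metric_zero)
  have W: "g p ?W ?x = 0"
    using X Y metric_sym[of "X p" p "Y p"] metric_sym[of "X p" p ?x] metric_sym[of "Y p" p ?x]
    by (simp add: S_eq metric_simps T)
  have "S p ?W ?x = - \<kappa> p *\<^sub>R ?W"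
    using W X Y by (simp add: S_xi_right)
  then show ?thesis
    using X Y by (simp add: curvature_xi S_xi_right S_simps) (simp add: algebra_simps)
qed

text \<open>Pair symmetry and skewness move \<xi> to the last argument of \<open>R\<close>, where
  \<open>curvature_xi_eq\<close> applies.\<close>

lemma curvature_xi_middle:
  assumes Y: "Y \<in> vector_fields A" and Z: "Z \<in> vector_fields A"
  shows "R Y \<xi> Z = fscale \<kappa> (fscale (on_fields g Y Z) \<xi> - fscale (on_fields g \<xi> Z) Y)"
proof (rule ext, rule tangent_eqI)
  fix p w assume w: "w \<in> tangent_space A p"
  obtain W where W: "W \<in> vector_fields A" "W p = w" using vector_field_extension[OF w] .
  have "on_fields g (R Y \<xi> Z) W p = - on_fields g (R Z W \<xi>) Y p"
    using assms W(1) by (simp add: curvature_pair_sym[of Y \<xi> Z W] curvature_skew[of Z W Y \<xi>])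
  then show "g p (R Y \<xi> Z p) w
      = g p (fscale \<kappa> (fscale (on_fields g Y Z) \<xi> - fscale (on_fields g \<xi> Z) Y) p) w"
    using assms W w metric_sym[of "Y p" p "Z p"] metric_sym[of "\<xi> p" p "Z p"]
      metric_sym[of w p "\<xi> p"] metric_sym[of w p "Y p"]
    by (simp add: on_fields_apply[of g _ _ p] curvature_xi_eq fscale_apply metric_simps)
      (simp add: algebra_simps)
qed (use assms in simp_all)

text \<open>A Leibniz rule for the shape shared by \<open>curvature_xi_middle\<close> and
  \<open>constant_curvature\<close>.\<close>

lemma connection_constant_curvature:
  assumes "X \<in> vector_fields A" "Y \<in> vector_fields A" "Z \<in> vector_fields A"
    "smooth_fun A f" "smooth_fun A h"
  shows "D X (fscale \<kappa> (fscale f Y - fscale h Z)) p = \<kappa> p *\<^sub>R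
    (X p f *\<^sub>R Y p + f p *\<^sub>R D X Y p - (X p h *\<^sub>R Z p + h p *\<^sub>R D X Z p))"
  using assms by (simp add: connection_fscale connection_diff fscale_apply norm_xi_constant)

text \<open>R(Y,\<xi>)Z already has constant curvature form, but \<xi> is not parallel for
  \<open>D\<close>. The slot term R(Y, D_X \<xi>)Z brings in the unknown R(Y,X)Z with factor
  -\<kappa>, so the derivative measures how far it is from that form.\<close>

lemma cov_deriv_curvature_xi:
  assumes X: "X \<in> vector_fields A" and Y: "Y \<in> vector_fields A" and Z: "Z \<in> vector_fields A"
  shows "cov_deriv13 D R X Y \<xi> Z p = \<kappa> p *\<^sub>R (R Y X Z p
    + \<kappa> p *\<^sub>R (g p (X p) (Z p) *\<^sub>R Y p - g p (Y p) (Z p) *\<^sub>R X p))"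
proof -
  have RD: "R Y (D X \<xi>) Z p = g p (X p) (\<xi> p) *\<^sub>R R Y \<xi> Z p - \<kappa> p *\<^sub>R R Y X Z p"
    using assms by (simp add: connection_xi_eq curvature_diff curvature_fscale fscale_apply
      on_fields_apply[of g X])
  have Dx: "D X \<xi> p = g p (X p) (\<xi> p) *\<^sub>R \<xi> p - \<kappa> p *\<^sub>R X p"
    using X by (simp add: connection_xi_eq fscale_apply on_fields_apply[of g X])
  show ?thesis
    using assms metric_sym[of "\<xi> p" p "Z p"]
    by (simp add: cov_deriv13_def curvature_xi_middle connection_constant_curvature metric_compatible RD)
      (simp add: fscale_apply on_fields_apply[of g _ Z] on_fields_apply[of g Y "D X Z"]
       on_fields_apply[of g \<xi> "D X Z"] Dx metric_simps algebra_simps)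
qed

lemma cov_deriv_xi_curvature:
  assumes "X \<in> vector_fields A" "Y \<in> vector_fields A" "Z \<in> vector_fields A"
  shows "cov_deriv13 D R \<xi> X Y Z = 0"
proof -
  have "Dbar \<xi> W = D \<xi> W" if "W \<in> vector_fields A" for W
    by (rule ext) (simp add: Dbar_def on_fields_apply S_xi_left that)
  then have "cov_deriv13 D R \<xi> X Y Z = cov_deriv13 Dbar R \<xi> X Y Z"
    using assms by (simp add: cov_deriv13_def)
  then show ?thesis using assms by (simp add: Dbar_parallel(3))
qed

text \<open>The second Bianchi identity with \<nabla>_\<xi> R = 0 makes (\<nabla>_X R)(Y,\<xi>)Z
  symmetric in X and Y. By \<open>cov_deriv_curvature_xi\<close> it equals -\<kappa> K, where the
  deviation K is antisymmetric, so K = 0. In this sign convention the sectional curvature is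
  -\<kappa>.\<close>

lemma constant_curvature:
  assumes X: "X \<in> vector_fields A" and Y: "Y \<in> vector_fields A" and Z: "Z \<in> vector_fields A"
  shows "R X Y Z = fscale \<kappa> (fscale (on_fields g X Z) Y - fscale (on_fields g Y Z) X)"
proof (rule ext)
  fix p
  define K where "K = R X Y Z p - \<kappa> p *\<^sub>R (g p (X p) (Z p) *\<^sub>R Y p - g p (Y p) (Z p) *\<^sub>R X p)"
  \<comment> \<open>Antisymmetry of \<open>R\<close> passes to its derivative and puts the second
    Bianchi term into the form covered by \<open>cov_deriv_curvature_xi\<close>.\<close>
  have "cov_deriv13 D R Y \<xi> X Z = - cov_deriv13 D R Y X \<xi> Z"
    using assms by (simp add: cov_deriv13_def curvature_antisym[of X \<xi>] curvature_antisym[of X "D Y \<xi>"]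
      curvature_antisym[of "D Y X" \<xi>] connection_minus)
  moreover have "cov_deriv13 D R X Y \<xi> Z + cov_deriv13 D R Y \<xi> X Z = 0"
    using Bianchi_second[OF X Y xi Z] cov_deriv_xi_curvature[OF X Y Z] by simp
  ultimately have "cov_deriv13 D R X Y \<xi> Z p = cov_deriv13 D R Y X \<xi> Z p"
    by simp
  moreover have "cov_deriv13 D R X Y \<xi> Z p = \<kappa> p *\<^sub>R - K"
    using assms curvature_antisym[OF X Y Z] by (simp add: cov_deriv_curvature_xi K_def algebra_simps)
  moreover have "cov_deriv13 D R Y X \<xi> Z p = \<kappa> p *\<^sub>R K"
    using assms by (simp add: cov_deriv_curvature_xi K_def algebra_simps)
  moreover have "\<kappa> p \<noteq> 0" using nonnull[of p] by (simp add: on_fields_apply)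
  ultimately have "K = - K" by (metis scaleR_cancel_left)
  then have "K = 0" by (rule real_vector_eq_minus_self)
  then show "R X Y Z p = fscale \<kappa> (fscale (on_fields g X Z) Y - fscale (on_fields g Y Z) X) p"
    by (simp add: K_def fscale_apply on_fields_apply[of g _ Z])
qed

text \<open>In the constant curvature formula g is parallel and \<kappa> has zero derivative, so the
  Leibniz terms match the slot terms exactly.\<close>

lemma locally_symmetric: "locally_symmetric A D"
  unfolding locally_symmetric_def
proof (intro ballI ext)
  fix X Y Z W p
  assume "X \<in> vector_fields A" "Y \<in> vector_fields A" "Z \<in> vector_fields A" "W \<in> vector_fields A"
  then have "cov_deriv13 D R X Y Z W p = 0"
    by (simp add: cov_deriv13_def constant_curvature connection_constant_curvature metric_compatible)
      (simp add: fscale_apply on_fields_apply[of g _ _ p] algebra_simps)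
  then show "cov_deriv13 D R X Y Z W p f = (0 :: 'm vfield) p f" for f by simp
qed

end

theorem proposition1:
  fixes A :: "('m::{t2_space, second_countable_topology}, 'n::finite) chart set"
    and g :: "'m tensor02"
    and D :: "'m conn"
  assumes "CARD('n) \<ge> 3"
    and "connected (UNIV :: 'm set)"
    and "smooth_manifold A"
    and "lorentzian_metric A g"
    and "homogeneous A g"
    and "levi_civita A g D"
    and "\<exists>S. homogeneous_structure A g D S \<and> nondegenerate_type_T1_T3 A g S"
  shows "locally_symmetric A D"
proof -
  obtain S \<xi> T where "homogeneous_structure A g D S" "T1_T3_decomposition A g S \<xi> T"
    "\<And>p. g p (\<xi> p) (\<xi> p) \<noteq> 0"
    using assms(7) unfolding nondegenerate_type_T1_T3_def by blast
  then interpret homogeneous_T1_T3 A g D S T \<xi>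
    using assms by unfold_locales auto
  show ?thesis by (rule locally_symmetric)
qed

end
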